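(* Let $K\in L^2(X\times X,\mu\times\mu)$. If the integral operator $\mathcal{K}(f)=\int_X K(\cdot,y)f(y)\,d\mu(y)$ on $L^2(X,\mu)$ is trace-class, then $\lim_{n\to\infty}\mathrm{tr}(\mathcal{E}^n_K)=\mathrm{tr}(\mathcal{K})$.
   Context: Standing setting: $X$ is a Hausdorff, locally compact, second countable topological space and $\mu$ is a non-degenerate, $\sigma$-finite, locally finite Borel measure on $X$. Fix an open cover of $X$ by open sets, each the interior of a compact set and of finite $\mu$-measure, and extract a countable subcover $\{\mathcal{A}_k\}_{k\ge 0}$. Let $\mathcal{P}_0$ be the partition of $X$ consisting of $\mathcal{A}_k\setminus\overline{\mathcal{A}_0\cup\dots\cup\mathcal{A}_{k-1}}$ and $\partial\mathcal{A}_k\setminus\overline{\mathcal{A}_0\cup\dots\cup\mathcal{A}_{k-1}}$, $k\ge0$. Fix a countable base $\{\mathcal{U}_n\}_{n\ge0}$ and set $\mathcal{P}_{n+1}=\{\mathcal{U}_n\cap A\}\cup\{(X\setminus\overline{\mathcal{U}_n})\cap A\}\cup\{\partial\mathcal{U}_n\cap A\}$, $A\in\mathcal{P}_n$. $O_n(x)$ is the unique element of $\mathcal{P}_n$ containing $x$; $\mathfrak{N}=\{x:\mu(O_m(x))=0\text{ for some }m\}$. For $u,v\in X\setminus\mathfrak{N}$, $E_n(K)(u,v)=\frac{1}{\mu(O_n(u))\mu(O_n(v))}\int_{O_n(u)}\int_{O_n(v)}K(x,y)\,d\mu(y)\,d\mu(x)$, and $\mathcal{E}^n_K$ is the integral operator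 on $L^2(X,\mu)$ with kernel $E_n(K)$. Trace-class: $\sum_{f\in\mathfrak{B}}\langle T^*Tf,f\rangle^{1/2}<\infty$ for every orthonormal basis $\mathfrak{B}$; $\mathrm{tr}$ denotes the trace. *)

theory Defs
  imports "HOL-Analysis.Analysis"
begin

definition part0 :: "(nat \<Rightarrow> 'a::topological_space set) \<Rightarrow> 'a set set" where
  "part0 A = (\<lambda>k. A k - closure (\<Union>i<k. A i)) ` UNIV
           \<union> (\<lambda>k. frontier (A k) - closure (\<Union>i<k. A i)) ` UNIV"

fun part :: "(nat \<Rightarrow> 'a::topological_space set) \<Rightarrow> (nat \<Rightarrow> 'a set) \<Rightarrow> nat \<Rightarrow> 'a set set" where
  "part A U 0 = part0 A"
| "part A U (Suc n) =
     (\<Union>B\<in>part A U n. {U n \<inter> B, (- closure (U n)) \<inter> B, frontier (U n) \<inter> B})"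

definition cell :: "(nat \<Rightarrow> 'a::topological_space set) \<Rightarrow> (nat \<Rightarrow> 'a set) \<Rightarrow> nat \<Rightarrow> 'a \<Rightarrow> 'a set" where
  "cell A U n x = (THE B. B \<in> part A U n \<and> x \<in> B)"

definition null_cells :: "'a::topological_space measure \<Rightarrow> (nat \<Rightarrow> 'a set) \<Rightarrow> (nat \<Rightarrow> 'a set) \<Rightarrow> 'a set" where
  "null_cells M A U = {x. \<exists>m. emeasure M (cell A U m x) = 0}"

text \<open>The averaged kernel E_n(K); set to 0 outside (X - N) x (X - N) (a null set).\<close>
definition avg_kernel ::
  "'a::topological_space measure \<Rightarrow> (nat \<Rightarrow> 'a set) \<Rightarrow> (nat \<Rightarrow> 'a set) \<Rightarrow> nat
    \<Rightarrow> ('a \<times> 'a \<Rightarrow> complex) \<Rightarrow> 'a \<times> 'a \<Rightarrow> complex" where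
  "avg_kernel M A U n K = (\<lambda>(u, v).
     if u \<in> null_cells M A U \<or> v \<in> null_cells M A U then 0
     else (set_lebesgue_integral M (cell A U n u)
              (\<lambda>x. set_lebesgue_integral M (cell A U n v) (\<lambda>y. K (x, y))))
          / complex_of_real (measure M (cell A U n u) * measure M (cell A U n v)))"

definition L2 :: "'a measure \<Rightarrow> ('a \<Rightarrow> complex) \<Rightarrow> bool" where
  "L2 M f \<longleftrightarrow> f \<in> borel_measurable M \<and> integrable M (\<lambda>x. (cmod (f x))\<^sup>2)"

definition l2_inner :: "'a measure \<Rightarrow> ('a \<Rightarrow> complex) \<Rightarrow> ('a \<Rightarrow> complex) \<Rightarrow> complex" where
  "l2_inner M f g = (LINT x|M. f x * cnj (g x))"

definition onb :: "'a measure \<Rightarrow> ('a \<Rightarrow> complex) set \<Rightarrow> bool" where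
  "onb M B \<longleftrightarrow> (\<forall>f\<in>B. L2 M f)
     \<and> (\<forall>f\<in>B. \<forall>g\<in>B. l2_inner M f g = (if f = g then 1 else 0))
     \<and> (\<forall>h. L2 M h \<and> (\<forall>f\<in>B. l2_inner M h f = 0) \<longrightarrow> (AE x in M. h x = 0))"

definition int_op :: "'a measure \<Rightarrow> ('a \<times> 'a \<Rightarrow> complex) \<Rightarrow> ('a \<Rightarrow> complex) \<Rightarrow> ('a \<Rightarrow> complex)" where
  "int_op M K f = (\<lambda>x. LINT y|M. K (x, y) * f y)"

text \<open>S is the positive square root (T* T)^(1/2) of T* T on L^2:
  S maps L^2 to L^2, is self-adjoint and positive, and S S = T* T
  (written as <S f, S g> = <T f, T g>).\<close>
definition is_abs_op :: "'a measure \<Rightarrow> (('a \<Rightarrow> complex) \<Rightarrow> ('a \<Rightarrow> complex))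
    \<Rightarrow> (('a \<Rightarrow> complex) \<Rightarrow> ('a \<Rightarrow> complex)) \<Rightarrow> bool" where
  "is_abs_op M T S \<longleftrightarrow>
     (\<forall>f. L2 M f \<longrightarrow> L2 M (S f))
   \<and> (\<forall>f g. L2 M f \<longrightarrow> L2 M g \<longrightarrow> l2_inner M (S f) g = l2_inner M f (S g))
   \<and> (\<forall>f. L2 M f \<longrightarrow> Im (l2_inner M (S f) f) = 0 \<and> 0 \<le> Re (l2_inner M (S f) f))
   \<and> (\<forall>f g. L2 M f \<longrightarrow> L2 M g \<longrightarrow> l2_inner M (S f) (S g) = l2_inner M (T f) (T g))"

definition trace_class :: "'a measure \<Rightarrow> (('a \<Rightarrow> complex) \<Rightarrow> ('a \<Rightarrow> complex)) \<Rightarrow> bool" where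
  "trace_class M T \<longleftrightarrow> (\<forall>f. L2 M f \<longrightarrow> L2 M (T f)) \<and>
     (\<exists>S. is_abs_op M T S \<and>
        (\<forall>B. onb M B \<longrightarrow> (\<lambda>f. Re (l2_inner M (S f) f)) summable_on B))"

text \<open>Trace: sum of <T f, f> over an orthonormal basis (basis-independent for trace-class T).\<close>
definition trace :: "'a measure \<Rightarrow> (('a \<Rightarrow> complex) \<Rightarrow> ('a \<Rightarrow> complex)) \<Rightarrow> complex" where
  "trace M T = infsum (\<lambda>f. l2_inner M (T f) f) (SOME B. onb M B)"

end

theory Submission
  imports Defs "HOL-Library.Function_Algebras"
begin

text \<open>
  Averaging over the cells of the \<open>n\<close>-th partition is an orthogonal projection \<open>P\<^sub>n\<close> on \<open>L\<^sup>2\<close>,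
  the operator with kernel \<open>E\<^sub>n(K)\<close> is \<open>P\<^sub>n \<K> P\<^sub>n\<close>, and \<open>P\<^sub>n \<rightarrow> I\<close> strongly because the cells
  generate the Borel sets.  Gram-Schmidt with respect to the positive form \<open>\<langle>|\<K>| f, g\<rangle>\<close> yields
  vectors \<open>h\<^sub>k\<close> such that, with \<open>a\<^sub>k = |\<K>| h\<^sub>k\<close> and \<open>d\<^sub>k = \<K> h\<^sub>k\<close>, one has
  \<open>\<K> f = \<Sum>\<^sub>k \<langle>f, a\<^sub>k\<rangle> d\<^sub>k\<close> and \<open>\<Sum>\<^sub>k \<parallel>a\<^sub>k\<parallel>\<parallel>d\<^sub>k\<parallel> = tr |\<K>| < \<infinity>\<close>; this replaces the singular value
  decomposition and needs no spectral theory.  Hence \<open>tr \<K> = \<Sum>\<^sub>k \<langle>d\<^sub>k, a\<^sub>k\<rangle>\<close> and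
  \<open>tr (P\<^sub>n \<K> P\<^sub>n) = \<Sum>\<^sub>k \<langle>P\<^sub>n d\<^sub>k, P\<^sub>n a\<^sub>k\<rangle>\<close>, and the claim follows by dominated convergence.
\<close>

section \<open>Semi-inner product spaces\<close>

text \<open>The locale is instantiated twice: with the inner product, and with the form <S f, g>,
  where \<open>S\<close> is the positive root of T* T and T the integral operator. The first
  vanishes on null functions, since functions are not identified almost everywhere, the second on
  the kernel of \<open>S\<close>; hence only semi-definiteness is assumed, and Gram-Schmidt may
  return zero vectors. The expansion holds because T is continuous for the seminorm of the second
  form: ||T u||^2 = ||S u||^2 <= \<kappa> <S u, u>, with \<kappa> the norm of the kernel. The
  remainder of f after N steps tends to 0 in that seminorm, so T of it tends to 0 in norm. The same
  remainders give <S f, f> = sum_k |<f, a_k>|^2. Summing over an orthonormal basis and exchanging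
  the sums identifies sum_k ||a_k||^2 with the trace of \<open>S\<close>, while ||d_k|| = ||a_k||. A
  basis is a maximal orthonormal set, and \<open>trace\<close> picks one by choice. So Parseval has
  to be derived from completeness, and the trace formula has to hold in every basis.\<close>

locale semi_inner =
  fixes V :: "'v::ab_group_add set" and scl :: "complex \<Rightarrow> 'v \<Rightarrow> 'v" and b :: "'v \<Rightarrow> 'v \<Rightarrow> complex"
  assumes V_zero [simp]: "0 \<in> V"
    and V_add [simp]: "f \<in> V \<Longrightarrow> g \<in> V \<Longrightarrow> f + g \<in> V"
    and V_minus [simp]: "f \<in> V \<Longrightarrow> - f \<in> V"
    and V_scl [simp]: "f \<in> V \<Longrightarrow> scl c f \<in> V"
    and b_add: "f \<in> V \<Longrightarrow> g \<in> V \<Longrightarrow> h \<in> V \<Longrightarrow> b (f + g) h = b f h + b g h"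
    and b_scl: "f \<in> V \<Longrightarrow> h \<in> V \<Longrightarrow> b (scl c f) h = c * b f h"
    and b_herm: "f \<in> V \<Longrightarrow> g \<in> V \<Longrightarrow> b g f = cnj (b f g)"
    and b_pos: "f \<in> V \<Longrightarrow> 0 \<le> Re (b f f)"
begin

lemma V_diff [simp]: "f \<in> V \<Longrightarrow> g \<in> V \<Longrightarrow> f - g \<in> V"
  using V_add[of f "- g"] by simp

lemma V_sum [simp]: "(\<And>i. i \<in> F \<Longrightarrow> f i \<in> V) \<Longrightarrow> (\<Sum>i\<in>F. f i) \<in> V"
  by (induction F rule: infinite_finite_induct) auto

lemma b_zero [simp]: "h \<in> V \<Longrightarrow> b 0 h = 0"
  using b_add[of 0 0 h] by simp

lemma b_minus: "f \<in> V \<Longrightarrow> h \<in> V \<Longrightarrow> b (- f) h = - b f h"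
  using b_add[of f "- f" h] by (simp add: eq_neg_iff_add_eq_0 add.commute)

lemma b_diff: "f \<in> V \<Longrightarrow> g \<in> V \<Longrightarrow> h \<in> V \<Longrightarrow> b (f - g) h = b f h - b g h"
  using b_add[of f "- g" h] by (simp add: b_minus)

lemma b_sum: "(\<And>i. i \<in> F \<Longrightarrow> f i \<in> V) \<Longrightarrow> h \<in> V \<Longrightarrow> b (\<Sum>i\<in>F. f i) h = (\<Sum>i\<in>F. b (f i) h)"
  by (induction F rule: infinite_finite_induct) (auto simp: b_add)

lemma b_zero_right [simp]: "h \<in> V \<Longrightarrow> b h 0 = 0"
  using b_herm[of 0 h] by simp

lemma b_add_right: "f \<in> V \<Longrightarrow> g \<in> V \<Longrightarrow> h \<in> V \<Longrightarrow> b h (f + g) = b h f + b h g"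
  using b_herm[of f h] b_herm[of g h] b_herm[of "f + g" h] by (simp add: b_add)

lemma b_diff_right: "f \<in> V \<Longrightarrow> g \<in> V \<Longrightarrow> h \<in> V \<Longrightarrow> b h (f - g) = b h f - b h g"
  using b_herm[of f h] b_herm[of g h] b_herm[of "f - g" h] by (simp add: b_diff)

lemma b_scl_right: "f \<in> V \<Longrightarrow> h \<in> V \<Longrightarrow> b h (scl c f) = cnj c * b h f"
  using b_herm[of f h] b_herm[of "scl c f" h] by (simp add: b_scl)

lemma b_sum_right:
  "(\<And>i. i \<in> F \<Longrightarrow> f i \<in> V) \<Longrightarrow> h \<in> V \<Longrightarrow> b h (\<Sum>i\<in>F. f i) = (\<Sum>i\<in>F. b h (f i))"
  by (induction F rule: infinite_finite_induct) (auto simp: b_add_right)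

lemma b_orth_sym: "f \<in> V \<Longrightarrow> g \<in> V \<Longrightarrow> b f g = 0 \<Longrightarrow> b g f = 0"
  using b_herm[of f g] by simp

lemma b_self: "f \<in> V \<Longrightarrow> b f f = of_real (Re (b f f))"
  using b_herm[of f f] by (simp add: complex_eq_iff)

text \<open>The form may vanish on \<open>g\<close>, so \<open>g\<close> cannot be normalised.
  Positivity is tested on f - s \<beta> g for every real s; the factor \<beta> = b f g makes the
  cross terms real.\<close>

lemma Cauchy_Schwarz:
  assumes f: "f \<in> V" and g: "g \<in> V"
  shows "(cmod (b f g))\<^sup>2 \<le> Re (b f f) * Re (b g g)"
proof -
  define \<beta> where "\<beta> = b f g"
  have gf: "b g f = cnj \<beta>" using b_herm[OF f g] \<beta>_def by simp
  have key: "0 \<le> Re (b f f) - 2 * s * (cmod \<beta>)\<^sup>2 + s\<^sup>2 * (cmod \<beta>)\<^sup>2 * Re (b g g)" for s :: real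
  proof -
    define l where "l = of_real s * \<beta>"
    have "b (f - scl l g) (f - scl l g) = b f f - cnj l * \<beta> - l * cnj \<beta> + l * cnj l * b g g"
      using f g by (simp add: b_diff b_diff_right b_scl b_scl_right gf \<beta>_def[symmetric] algebra_simps)
    also have "\<dots> = b f f - of_real (2 * s * (cmod \<beta>)\<^sup>2) + of_real (s\<^sup>2 * (cmod \<beta>)\<^sup>2) * b g g"
      unfolding l_def complex_cnj_mult complex_cnj_complex_of_real of_real_mult complex_norm_square
      by (simp add: algebra_simps power2_eq_square[of "complex_of_real s"])
    finally have "Re (b (f - scl l g) (f - scl l g))
        = Re (b f f) - 2 * s * (cmod \<beta>)\<^sup>2 + s\<^sup>2 * (cmod \<beta>)\<^sup>2 * Re (b g g)"
      by (simp del: of_real_mult of_real_power)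
    then show ?thesis using b_pos[of "f - scl l g"] f g by simp
  qed
  show ?thesis
  proof (cases "Re (b g g) = 0")
    case True
    have "cmod \<beta> = 0"
    proof (rule ccontr)
      assume "cmod \<beta> \<noteq> 0"
      then have p: "(cmod \<beta>)\<^sup>2 > 0" by simp
      \<comment> \<open>At s = t the polynomial of \<open>key\<close> equals - Re (b f f) - 2, which
        is negative.\<close>
      define t where "t = (Re (b f f) + 1) / (cmod \<beta>)\<^sup>2"
      have "t * (cmod \<beta>)\<^sup>2 = Re (b f f) + 1" using p by (simp add: t_def)
      then show False using key[of t] True b_pos[OF f] by simp
    qed
    then show ?thesis using True \<beta>_def by simp
  next
    case False
    then have p: "Re (b g g) > 0" using b_pos[OF g] by simp
    \<comment> \<open>The value s = 1 / Re (b g g) minimises the polynomial of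
      \<open>key\<close>.\<close>
    have "0 \<le> Re (b f f) - (cmod \<beta>)\<^sup>2 / Re (b g g)"
      using key[of "1 / Re (b g g)"] p by (simp add: field_simps power2_eq_square)
    then show ?thesis using p unfolding \<beta>_def by (simp add: field_simps)
  qed
qed

definition nrm :: "'v \<Rightarrow> real" where "nrm f = sqrt (Re (b f f))"

lemma nrm_nonneg [simp]: "f \<in> V \<Longrightarrow> 0 \<le> nrm f"
  by (simp add: nrm_def b_pos)

lemma nrm_sq: "f \<in> V \<Longrightarrow> (nrm f)\<^sup>2 = Re (b f f)"
  by (simp add: nrm_def b_pos)

lemma b_le_nrm: "f \<in> V \<Longrightarrow> g \<in> V \<Longrightarrow> cmod (b f g) \<le> nrm f * nrm g"
  using Cauchy_Schwarz[of f g]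
  by (metis b_pos nrm_def real_le_rsqrt real_sqrt_mult)

lemma nrm_add: assumes "f \<in> V" "g \<in> V" shows "nrm (f + g) \<le> nrm f + nrm g"
proof (rule power2_le_imp_le)
  have "Re (b g f) = Re (b f g)" using b_herm[of f g] assms by simp
  then have "(nrm (f + g))\<^sup>2 = Re (b f f) + 2 * Re (b f g) + Re (b g g)"
    using assms by (simp add: nrm_sq b_add b_add_right)
  also have "\<dots> \<le> (nrm f)\<^sup>2 + 2 * (nrm f * nrm g) + (nrm g)\<^sup>2"
    using assms b_le_nrm[of f g] complex_Re_le_cmod[of "b f g"] by (simp add: nrm_sq)
  finally show "(nrm (f + g))\<^sup>2 \<le> (nrm f + nrm g)\<^sup>2" by (simp add: power2_sum)
qed (use assms in simp)

lemma nrm_minus: "f \<in> V \<Longrightarrow> nrm (- f) = nrm f"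
  using b_herm[of "- f" f] by (simp add: nrm_def b_minus)

lemma nrm_diff: "f \<in> V \<Longrightarrow> g \<in> V \<Longrightarrow> nrm (f - g) \<le> nrm f + nrm g"
  using nrm_add[of f "- g"] by (simp add: nrm_minus)

section \<open>Finite orthonormal expansions and Bessel's inequality\<close>

definition proj :: "'v set \<Rightarrow> 'v \<Rightarrow> 'v" where
  "proj F a = (\<Sum>f\<in>F. scl (b a f) f)"

lemma proj_diff:
  assumes "F \<subseteq> G" "finite G"
  shows "proj G a - proj F a = proj (G - F) a"
  using assms by (simp add: proj_def sum_diff)

definition orthonormal_set :: "'v set \<Rightarrow> bool" where
  "orthonormal_set B \<longleftrightarrow> B \<subseteq> V \<and> (\<forall>f\<in>B. \<forall>g\<in>B. b f g = (if f = g then 1 else 0))"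

context
  fixes B assumes on: "orthonormal_set B"
begin

lemma orthonormal_set_subset: "B \<subseteq> V"
  using on by (simp add: orthonormal_set_def)

lemma orthonormal_setD: "f \<in> B \<Longrightarrow> g \<in> B \<Longrightarrow> b f g = (if f = g then 1 else 0)"
  using on by (simp add: orthonormal_set_def)

lemma proj_in: "F \<subseteq> B \<Longrightarrow> a \<in> V \<Longrightarrow> proj F a \<in> V"
  using orthonormal_set_subset by (auto simp: proj_def intro!: V_sum)

lemma b_proj:
  assumes "F \<subseteq> B" "finite F" "g \<in> B" "a \<in> V"
  shows "b (proj F a) g = (if g \<in> F then b a g else 0)"
proof -
  have "b (proj F a) g = (\<Sum>f\<in>F. b a f * b f g)"
    unfolding proj_def using assms orthonormal_set_subset by (subst b_sum) (auto simp: b_scl subset_eq)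
  also have "\<dots> = (\<Sum>f\<in>F. if f = g then b a g else 0)"
    using assms by (intro sum.cong refl) (auto simp: orthonormal_setD subset_eq)
  finally show ?thesis using assms by simp
qed

lemma b_proj_right:
  assumes "F \<subseteq> B" "finite F" "a \<in> V"
  shows "b a (proj F a) = of_real (\<Sum>f\<in>F. (cmod (b a f))\<^sup>2)"
  unfolding proj_def using assms orthonormal_set_subset
  by (subst b_sum_right) (auto simp: b_scl_right subset_eq complex_norm_square mult.commute simp del: of_real_power)

lemma b_proj_proj:
  assumes "F \<subseteq> B" "finite F" "a \<in> V"
  shows "b (proj F a) (proj F a) = of_real (\<Sum>f\<in>F. (cmod (b a f))\<^sup>2)"
proof -
  have "b (proj F a) (proj F a) = (\<Sum>f\<in>F. cnj (b a f) * b (proj F a) f)"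
    apply (subst (2) proj_def)
    using assms orthonormal_set_subset by (subst b_sum_right) (auto simp: b_scl_right subset_eq proj_in)
  also have "\<dots> = (\<Sum>f\<in>F. cnj (b a f) * b a f)"
    using assms by (intro sum.cong refl) (simp add: b_proj subset_eq)
  finally show ?thesis by (simp add: complex_norm_square mult.commute del: of_real_power)
qed

lemma proj_residual:
  assumes "F \<subseteq> B" "finite F" "a \<in> V"
  shows "Re (b (a - proj F a) (a - proj F a)) = Re (b a a) - (\<Sum>f\<in>F. (cmod (b a f))\<^sup>2)"
proof -
  have "b (proj F a) a = cnj (b a (proj F a))"
    using assms by (intro b_herm) (auto simp: proj_in)
  then show ?thesis using assms
    by (simp add: b_diff b_diff_right proj_in b_proj_right b_proj_proj del: of_real_sum)
qed

lemma Bessel: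
  assumes "F \<subseteq> B" "finite F" "a \<in> V"
  shows "(\<Sum>f\<in>F. (cmod (b a f))\<^sup>2) \<le> Re (b a a)"
  using proj_residual[OF assms] b_pos[of "a - proj F a"] assms by (simp add: proj_in)

end

text \<open>Zero vectors are allowed so that Gram-Schmidt applies to linearly dependent sequences.\<close>

definition weak_orthonormal :: "(nat \<Rightarrow> 'v) \<Rightarrow> bool" where
  "weak_orthonormal h \<longleftrightarrow> (\<forall>k. h k \<in> V) \<and> (\<forall>j k. j \<noteq> k \<longrightarrow> b (h j) (h k) = 0)
     \<and> (\<forall>k. b (h k) (h k) = 1 \<or> h k = 0)"

text \<open>Nothing about \<open>h\<close> is presupposed, so that the recursion equation of
  Gram-Schmidt can be written with it before orthonormality is known.\<close>

definition resid :: "(nat \<Rightarrow> 'v) \<Rightarrow> nat \<Rightarrow> 'v \<Rightarrow> 'v" where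
  "resid h N f = f - (\<Sum>k<N. scl (b f (h k)) (h k))"

lemma resid_in [simp]: "(\<And>k. k < N \<Longrightarrow> h k \<in> V) \<Longrightarrow> f \<in> V \<Longrightarrow> resid h N f \<in> V"
  by (auto simp: resid_def intro!: V_diff V_sum)

context
  fixes h assumes h: "weak_orthonormal h"
begin

lemma wo_in [simp]: "h k \<in> V"
  using h by (auto simp: weak_orthonormal_def)

lemma resid_orth: assumes f: "f \<in> V" and j: "j < N" shows "b (resid h N f) (h j) = 0"
proof -
  have "(\<Sum>k<N. b f (h k) * b (h k) (h j)) = (\<Sum>k<N. if k = j then b f (h j) else 0)"
  proof (intro sum.cong refl)
    fix k
    show "b f (h k) * b (h k) (h j) = (if k = j then b f (h j) else 0)"
      using h f b_zero_right[of f] b_zero_right[of "h j"] unfolding weak_orthonormal_def by (cases "b (h j) (h j) = 1") auto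
  qed
  then show ?thesis
    using f j by (simp add: resid_def b_diff b_sum b_scl)
qed

lemma resid_inner: assumes f: "f \<in> V" and g: "g \<in> V"
  shows "b (resid h N f) g = b f g - (\<Sum>k<N. b f (h k) * b (h k) g)"
  using f g by (simp add: resid_def b_diff b_sum b_scl)

lemma resid_self: assumes f: "f \<in> V"
  shows "Re (b (resid h N f) (resid h N f)) = Re (b f f) - (\<Sum>k<N. (cmod (b f (h k)))\<^sup>2)"
proof -
  \<comment> \<open>The remainder is orthogonal to all that was subtracted, so one of its two copies
    may be replaced by \<open>f\<close>.\<close>
  have "b (resid h N f) (resid h N f) = b (resid h N f) f"
    using f by (subst (2) resid_def) (simp add: b_diff_right b_sum_right b_scl_right resid_orth)
  also have "\<dots> = b f f - (\<Sum>k<N. of_real ((cmod (b f (h k)))\<^sup>2))"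
    using f by (simp add: resid_inner b_herm[of f "h _"] complex_norm_square del: of_real_power)
  finally show ?thesis by (simp del: of_real_power)
qed

text \<open>The locale has no distributive law for \<open>scl\<close>; scaling is known only through
  \<open>b\<close>. Linearity of the remainder is therefore expressed after pairing with a vector
  \<open>u\<close>.\<close>

lemma resid_diff: assumes f: "f \<in> V" and g: "g \<in> V" and u: "u \<in> V"
  shows "b (resid h N (f - g)) u = b (resid h N f) u - b (resid h N g) u"
  using assms by (simp add: resid_inner b_diff algebra_simps sum_subtractf)

end

text \<open>A vector that depends on its predecessors up to a vector of seminorm zero yields 0
  rather than being skipped. The output thus keeps the indexing of \<open>e\<close>: its first N
  vectors absorb the first N vectors of \<open>e\<close>.\<close>

function gram_schmidt :: "(nat \<Rightarrow> 'v) \<Rightarrow> nat \<Rightarrow> 'v" where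
  "gram_schmidt e n = (let r = e n - (\<Sum>k\<in>{..<n}. scl (b (e n) (gram_schmidt e k)) (gram_schmidt e k))
     in if b r r = 0 then 0 else scl (of_real (1 / sqrt (Re (b r r)))) r)"
  by pat_completeness auto
termination
  by (relation "inv_image less_than snd") auto

declare gram_schmidt.simps [simp del]

lemma gram_schmidt_eq:
  "gram_schmidt e n = (let r = resid (gram_schmidt e) n (e n)
     in if b r r = 0 then 0 else scl (of_real (1 / sqrt (Re (b r r)))) r)"
  by (subst gram_schmidt.simps) (simp add: resid_def)

text \<open>Closure under sums is recovered from differences by f + g = f - (0 - g). The lemma is
  applied with \<open>V\<close> itself and later with \<open>ev_fixed\<close>.\<close>

lemma gram_schmidt_subspace:
  assumes "0 \<in> Q" "\<And>f g. f \<in> Q \<Longrightarrow> g \<in> Q \<Longrightarrow> f - g \<in> Q" "\<And>c f. f \<in> Q \<Longrightarrow> scl c f \<in> Q"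
    and e: "\<And>n. e n \<in> Q"
  shows "gram_schmidt e n \<in> Q"
proof (induction n rule: less_induct)
  case (less n)
  have add: "f + g \<in> Q" if "f \<in> Q" "g \<in> Q" for f g
    using assms(2)[OF that(1) assms(2)[OF assms(1) that(2)]] by simp
  have "(\<Sum>k\<in>F. scl (b (e n) (gram_schmidt e k)) (gram_schmidt e k)) \<in> Q"
    if "finite F" "F \<subseteq> {..<n}" for F
    using that by (induction F) (auto simp: assms less.IH intro!: add)
  from this[of "{..<n}"] have "resid (gram_schmidt e) n (e n) \<in> Q"
    unfolding resid_def using assms e by simp
  then show ?case
    by (subst gram_schmidt_eq) (auto simp: Let_def assms)
qed

lemma weak_orthonormal_gram_schmidt:
  assumes e: "\<And>n. e n \<in> V"
  shows "weak_orthonormal (gram_schmidt e)"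
proof -
  let ?h = "gram_schmidt e"
  have hV [simp]: "?h n \<in> V" for n
    by (rule gram_schmidt_subspace) (auto simp: e)
  have *: "(\<forall>j<n. b (?h n) (?h j) = 0) \<and> (b (?h n) (?h n) = 1 \<or> ?h n = 0)" for n
  proof (induction n rule: less_induct)
    case (less n)
    \<comment> \<open>\<open>h'\<close> is the sequence cut off at index n. By the induction
      hypothesis it is weakly orthonormal on all indices, so \<open>resid_orth\<close> applies to
      it, and its remainder at stage n is the one wanted.\<close>
    define h' where "h' k = (if k < n then ?h k else 0)" for k
    define r where "r = resid ?h n (e n)"
    have "weak_orthonormal h'"
      unfolding weak_orthonormal_def
    proof (intro conjI allI impI)
      fix j k :: nat
      show "h' k \<in> V" by (simp add: h'_def)
      show "b (h' k) (h' k) = 1 \<or> h' k = 0" using less by (auto simp: h'_def)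
      assume "j \<noteq> k"
      then show "b (h' j) (h' k) = 0"
        using less b_orth_sym[of "?h k" "?h j"] by (cases "j < k") (auto simp: h'_def)
    qed
    from resid_orth[OF this e] have orth': "b (resid h' n (e n)) (h' j) = 0" if "j < n" for j
      using that by blast
    have "resid h' n (e n) = r" by (simp add: resid_def r_def h'_def)
    with orth' have orth: "b r (?h j) = 0" if "j < n" for j
      using that by (metis h'_def)
    have rV: "r \<in> V" by (simp add: r_def e)
    have eq: "?h n = (if b r r = 0 then 0 else scl (of_real (1 / sqrt (Re (b r r)))) r)"
      by (subst gram_schmidt_eq) (simp add: r_def Let_def)
    show ?case
    proof (cases "b r r = 0")
      case True then show ?thesis by (simp add: eq)
    next
      case False
      have br: "b r r = of_real (Re (b r r))" using b_self[OF rV] .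
      then have "Re (b r r) > 0" using False b_pos[OF rV] by (metis less_eq_real_def of_real_0)
      then have s: "of_real (1 / sqrt (Re (b r r))) * (of_real (1 / sqrt (Re (b r r))) * b r r) = 1"
        by (subst (3) br) (simp flip: of_real_mult)
      have "b (?h n) (?h n) = 1"
        using False rV s by (simp add: eq b_scl b_scl_right)
      then show ?thesis using orth False rV by (auto simp: eq b_scl)
    qed
  qed
  show ?thesis
    unfolding weak_orthonormal_def
  proof (intro conjI allI impI)
    fix j k :: nat
    show "?h k \<in> V" by simp
    show "b (?h k) (?h k) = 1 \<or> ?h k = 0" using * by blast
    assume "j \<noteq> k"
    then show "b (?h j) (?h k) = 0"
      using * b_orth_sym[of "?h k" "?h j"] by (cases "j < k") auto
  qed
qed

text \<open>The component of \<open>e j\<close> along the j-th output vector has squared modulus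
  \<open>Re (b r r)\<close>, with r the remainder at stage j. So stage j + 1 removes all that is
  left, and later stages only subtract further squares.\<close>

lemma resid_gram_schmidt:
  assumes e: "\<And>n. e n \<in> V" and "j < N"
  shows "Re (b (resid (gram_schmidt e) N (e j)) (resid (gram_schmidt e) N (e j))) = 0"
proof -
  let ?h = "gram_schmidt e"
  have wo: "weak_orthonormal ?h" by (rule weak_orthonormal_gram_schmidt[OF e])
  note [simp] = wo_in[OF wo]
  define r where "r = resid ?h j (e j)"
  have rV: "r \<in> V" by (simp add: r_def e)
  have eq: "?h j = (if b r r = 0 then 0 else scl (of_real (1 / sqrt (Re (b r r)))) r)"
    by (subst gram_schmidt_eq) (simp add: r_def Let_def)
  have "b r (?h j) = b (e j) (?h j)"
    using wo unfolding r_def resid_inner[OF wo e wo_in[OF wo]] by (simp add: weak_orthonormal_def)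
  moreover have "(cmod (b r (?h j)))\<^sup>2 = Re (b r r)"
  proof (cases "b r r = 0")
    case False
    have br: "b r r = of_real (Re (b r r))" using b_self[OF rV] .
    then have p: "Re (b r r) > 0" using False b_pos[OF rV] by (metis less_eq_real_def of_real_0)
    have "cmod (b r r) = Re (b r r)" by (subst br) (use p in \<open>simp only: norm_of_real abs_of_pos\<close>)
    then show ?thesis using False rV p
      by (simp add: eq b_scl_right norm_divide power_divide field_simps power2_eq_square)
  qed (use rV in \<open>simp add: eq\<close>)
  ultimately have 0: "Re (b (resid ?h (Suc j) (e j)) (resid ?h (Suc j) (e j))) = 0"
    using resid_self[OF wo e, of j j] unfolding resid_self[OF wo e] r_def by simp
  have "(\<Sum>k<Suc j. (cmod (b (e j) (?h k)))\<^sup>2) \<le> (\<Sum>k<N. (cmod (b (e j) (?h k)))\<^sup>2)"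
    using \<open>j < N\<close> by (intro sum_mono2) auto
  then have "Re (b (resid ?h N (e j)) (resid ?h N (e j))) \<le> 0"
    using 0 unfolding resid_self[OF wo e] by linarith
  then show ?thesis using b_pos[of "resid ?h N (e j)"] e by simp
qed

context
  fixes h assumes h: "weak_orthonormal h"
begin

lemma resid_sum_scl:
  assumes "\<And>i. i \<in> F \<Longrightarrow> v i \<in> V" and u: "u \<in> V"
  shows "b (resid h N (\<Sum>i\<in>F. scl (\<alpha> i) (v i))) u = (\<Sum>i\<in>F. \<alpha> i * b (resid h N (v i)) u)"
proof -
  have s: "(\<Sum>i\<in>F. scl (\<alpha> i) (v i)) \<in> V" using assms by simp
  have "b (resid h N (\<Sum>i\<in>F. scl (\<alpha> i) (v i))) u
      = (\<Sum>i\<in>F. \<alpha> i * b (v i) u) - (\<Sum>k<N. \<Sum>i\<in>F. \<alpha> i * b (v i) (h k) * b (h k) u)"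
    unfolding resid_inner[OF h s u] using assms wo_in[OF h]
    by (simp add: b_sum b_scl sum_distrib_right)
  also have "\<dots> = (\<Sum>i\<in>F. \<alpha> i * (b (v i) u - (\<Sum>k<N. b (v i) (h k) * b (h k) u)))"
    by (subst sum.swap) (simp add: sum_subtractf right_diff_distrib sum_distrib_left mult.assoc)
  finally show ?thesis using assms by (simp add: resid_inner[OF h])
qed

lemma resid_null_inner:
  assumes "s \<in> V" "u \<in> V" "Re (b (resid h N s) (resid h N s)) = 0"
  shows "b (resid h N s) u = 0"
  using Cauchy_Schwarz[of "resid h N s" u] assms wo_in[OF h] by simp

text \<open>Best approximation: since the remainder of \<open>s\<close> is null, f and f - s have
  the same remainder as far as \<open>b\<close> can tell, and a remainder is never longer than its
  vector.\<close>

lemma resid_le_of_null: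
  assumes f: "f \<in> V" and s: "s \<in> V" and null: "Re (b (resid h N s) (resid h N s)) = 0"
  shows "Re (b (resid h N f) (resid h N f)) \<le> Re (b (f - s) (f - s))"
proof -
  let ?r = "resid h N f" and ?q = "resid h N (f - s)"
  have V: "?r \<in> V" "?q \<in> V" using f s wo_in[OF h] by simp_all
  have eq: "b ?q u = b ?r u" if "u \<in> V" for u
    using resid_diff[OF h f s that, of N] resid_null_inner[OF s that null] by simp
  have "b ?r ?r = b ?q ?r" using eq[OF V(1)] by simp
  also have "\<dots> = cnj (b ?r ?q)" using V by (intro b_herm)
  also have "\<dots> = cnj (b ?q ?q)" using eq[OF V(2)] by simp
  finally have "Re (b ?r ?r) = Re (b ?q ?q)" by simp
  also have "\<dots> \<le> Re (b (f - s) (f - s))"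
    using resid_self[OF h, of "f - s" N] f s by (simp add: sum_nonneg)
  finally show ?thesis .
qed

lemma resid_antimono:
  assumes "f \<in> V" "N \<le> N'"
  shows "Re (b (resid h N' f) (resid h N' f)) \<le> Re (b (resid h N f) (resid h N f))"
  unfolding resid_self[OF h assms(1)] using assms(2) by (simp add: sum_mono2)

text \<open>The assumption \<open>approx\<close> says that the vectors absorbed after finitely many
  steps are dense. Density makes one remainder small, and monotonicity all later ones.\<close>

lemma resid_tendsto_0:
  assumes f: "f \<in> V"
    and approx: "\<And>\<epsilon>. \<epsilon> > 0 \<Longrightarrow> \<exists>s\<in>V. Re (b (f - s) (f - s)) < \<epsilon> \<and> (\<exists>N. Re (b (resid h N s) (resid h N s)) = 0)"
  shows "(\<lambda>N. Re (b (resid h N f) (resid h N f))) \<longlonglongrightarrow> 0"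
proof (rule order_tendstoI)
  fix a :: real assume "a < 0"
  then show "\<forall>\<^sub>F N in sequentially. a < Re (b (resid h N f) (resid h N f))"
    using b_pos[of "resid h _ f"] f wo_in[OF h] by (auto intro!: always_eventually less_le_trans[of a 0])
next
  fix \<epsilon> :: real assume "0 < \<epsilon>"
  then obtain s N where s: "s \<in> V" "Re (b (f - s) (f - s)) < \<epsilon>" "Re (b (resid h N s) (resid h N s)) = 0"
    using approx by blast
  have "Re (b (resid h n f) (resid h n f)) < \<epsilon>" if "N \<le> n" for n
    using resid_antimono[OF f that] resid_le_of_null[OF f s(1,3)] s(2) by linarith
  then show "\<forall>\<^sub>F N in sequentially. Re (b (resid h N f) (resid h N f)) < \<epsilon>"
    by (auto simp: eventually_sequentially)
qed

end

end

section \<open>The space of square-integrable functions\<close>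

lemma mult_le_sum_squares:
  fixes a b :: real
  assumes "0 \<le> a" "0 \<le> b" shows "a * b \<le> a\<^sup>2 + b\<^sup>2"
  using sum_squares_bound[of a b] mult_nonneg_nonneg[OF assms] by linarith

lemma borel_measurable_cnj [measurable (raw)]:
  "f \<in> borel_measurable M \<Longrightarrow> (\<lambda>x. cnj (f x)) \<in> borel_measurable M"
  by (rule borel_measurable_continuous_on[of cnj]) (intro continuous_intros)

lemma L2_measurable [measurable_dest]: "L2 M f \<Longrightarrow> f \<in> borel_measurable M"
  by (simp add: L2_def)

lemma L2_mult_integrable:
  assumes "L2 M f" "L2 M g"
  shows "integrable M (\<lambda>x. f x * g x)"
proof (rule Bochner_Integration.integrable_bound)
  show "integrable M (\<lambda>x. (cmod (f x))\<^sup>2 + (cmod (g x))\<^sup>2)"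
    using assms by (auto simp: L2_def)
  show "(\<lambda>x. f x * g x) \<in> borel_measurable M"
    using assms by (auto simp: L2_def)
  have "cmod (f x * g x) \<le> (cmod (f x))\<^sup>2 + (cmod (g x))\<^sup>2" for x
    unfolding norm_mult by (rule mult_le_sum_squares) auto
  then show "AE x in M. cmod (f x * g x) \<le> norm ((cmod (f x))\<^sup>2 + (cmod (g x))\<^sup>2)"
    by simp
qed

lemma L2_cnj: "L2 M f \<Longrightarrow> L2 M (\<lambda>x. cnj (f x))"
  by (simp add: L2_def borel_measurable_cnj)

lemma L2_inner_integrable:
  "L2 M f \<Longrightarrow> L2 M g \<Longrightarrow> integrable M (\<lambda>x. f x * cnj (g x))"
  by (intro L2_mult_integrable L2_cnj)

lemma L2_scale: "L2 M f \<Longrightarrow> L2 M (\<lambda>x. c * f x)"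
  by (auto simp: L2_def norm_mult power_mult_distrib)

lemma L2_add: assumes "L2 M f" "L2 M g" shows "L2 M (\<lambda>x. f x + g x)"
proof -
  have "integrable M (\<lambda>x. (cmod (f x + g x))\<^sup>2)"
  proof (rule Bochner_Integration.integrable_bound)
    show "integrable M (\<lambda>x. 2 * (cmod (f x))\<^sup>2 + 2 * (cmod (g x))\<^sup>2)"
      using assms by (auto simp: L2_def)
    show "(\<lambda>x. (cmod (f x + g x))\<^sup>2) \<in> borel_measurable M"
      using assms by (auto simp: L2_def)
    have "(cmod (f x + g x))\<^sup>2 \<le> 2 * (cmod (f x))\<^sup>2 + 2 * (cmod (g x))\<^sup>2" for x
    proof -
      have "(cmod (f x + g x))\<^sup>2 \<le> (cmod (f x) + cmod (g x))\<^sup>2"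
        by (intro power_mono norm_triangle_ineq) auto
      then show ?thesis
        using sum_squares_bound[of "cmod (f x)" "cmod (g x)"] by (simp add: power2_sum)
    qed
    then show "AE x in M. norm ((cmod (f x + g x))\<^sup>2) \<le> norm (2 * (cmod (f x))\<^sup>2 + 2 * (cmod (g x))\<^sup>2)"
      by simp
  qed
  then show ?thesis using assms by (auto simp: L2_def)
qed

lemma L2_diff: "L2 M f \<Longrightarrow> L2 M g \<Longrightarrow> L2 M (\<lambda>x. f x - g x)"
  using L2_add[of M f "\<lambda>x. (-1) * g x"] L2_scale[of M g "-1"] by simp

lemma L2_zero: "L2 M (\<lambda>x. 0)"
  by (simp add: L2_def)

lemma l2_inner_self: "L2 M f \<Longrightarrow> l2_inner M f f = of_real (LINT x|M. (cmod (f x))\<^sup>2)"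
  unfolding l2_inner_def integral_complex_of_real[symmetric]
  by (intro Bochner_Integration.integral_cong refl) (simp only: complex_norm_square)

lemma l2_inner_eq_0_iff: "L2 M f \<Longrightarrow> Re (l2_inner M f f) = 0 \<longleftrightarrow> (AE x in M. f x = 0)"
  by (subst l2_inner_self, simp)
    (auto simp: L2_def integral_nonneg_eq_0_iff_AE)

text \<open>Sums, differences and zero are the pointwise ones of \<open>Function_Algebras\<close>,
  so finite expansions are genuine functions. The rewrite rule turns membership in the carrier into
  \<open>L2 M f\<close>.\<close>

global_interpretation l2: semi_inner "Collect (L2 M)" "\<lambda>c f x. c * f x" "l2_inner M"
  rewrites "\<And>f. f \<in> Collect (L2 M) \<equiv> L2 M f"
  for M
proof -
  show "semi_inner (Collect (L2 M)) (\<lambda>c f x. c * f x) (l2_inner M)"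
  proof
    fix f g h :: "'a \<Rightarrow> complex" and c :: complex
    show "0 \<in> Collect (L2 M)" by (simp add: zero_fun_def L2_zero)
    assume "f \<in> Collect (L2 M)"
    then have f: "L2 M f" by simp
    show "- f \<in> Collect (L2 M)" using L2_scale[OF f, of "-1"] by (simp add: fun_Compl_def)
    show "(\<lambda>x. c * f x) \<in> Collect (L2 M)" using L2_scale[OF f] by simp
    show "0 \<le> Re (l2_inner M f f)" by (simp add: l2_inner_self f)
    {
      assume "g \<in> Collect (L2 M)"
      then have g: "L2 M g" by simp
      show "f + g \<in> Collect (L2 M)" using L2_add[OF f g] by (simp add: plus_fun_def)
      show "l2_inner M g f = cnj (l2_inner M f g)"
        using Bochner_Integration.integral_cnj[of M "\<lambda>x. f x * cnj (g x)"] by (simp add: l2_inner_def mult.commute)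
      assume "h \<in> Collect (L2 M)"
      then have h: "L2 M h" by simp
      show "l2_inner M (f + g) h = l2_inner M f h + l2_inner M g h"
        using L2_inner_integrable[OF f h] L2_inner_integrable[OF g h]
        unfolding l2_inner_def plus_fun_def by (simp add: distrib_right)
    }
    assume "h \<in> Collect (L2 M)"
    then have h: "L2 M h" by simp
    show "l2_inner M (\<lambda>x. c * f x) h = c * l2_inner M f h"
      unfolding l2_inner_def by (simp add: mult.assoc)
  qed
qed simp

abbreviation l2_norm :: "'a measure \<Rightarrow> ('a \<Rightarrow> complex) \<Rightarrow> real" where
  "l2_norm M \<equiv> semi_inner.nrm (l2_inner M)"

lemma l2_norm_sq: "L2 M f \<Longrightarrow> (l2_norm M f)\<^sup>2 = (LINT x|M. (cmod (f x))\<^sup>2)"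
  by (simp add: l2.nrm_sq l2_inner_self)

text \<open>Riesz-Fischer for a geometric rate, which is the case that Parseval needs. The rate
  forces convergence almost everywhere, and Fatou's lemma carries the estimate over to the
  limit.\<close>

lemma L2_fast_Cauchy_converges:
  assumes f: "\<And>n. L2 M (f n)"
    and c: "\<And>m n. n \<le> m \<Longrightarrow> (LINT x|M. (cmod (f m x - f n x))\<^sup>2) \<le> (1/4)^n"
  shows "\<exists>g. L2 M g \<and> (\<forall>n. (LINT x|M. (cmod (g x - f n x))\<^sup>2) \<le> (1/4)^n)"
proof -
  have [measurable]: "f n \<in> borel_measurable M" for n using f by (rule L2_measurable)
  have nn: "(\<integral>\<^sup>+x. ennreal ((cmod (f m x - f n x))\<^sup>2) \<partial>M) \<le> ennreal ((1/4)^n)" if "n \<le> m" for m n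
    using L2_diff[OF f f, of m n] c[OF that]
    by (subst nn_integral_eq_integral) (auto simp: L2_def ennreal_leI)
  have AE_conv: "AE x in M. convergent (\<lambda>n. f n x)"
  proof -
    \<comment> \<open>The weight 2^n turns the rate 4^-n into the summable 2^-n. Where the weighted
      sum is finite, the increments satisfy |f (Suc n) x - f n x|^2 <= C 2^-n and so decay
      geometrically.\<close>
    let ?D = "\<lambda>n x. ennreal (2^n * (cmod (f (Suc n) x - f n x))\<^sup>2)"
    have "(\<integral>\<^sup>+x. (\<Sum>n. ?D n x) \<partial>M) = (\<Sum>n. \<integral>\<^sup>+x. ?D n x \<partial>M)"
      by (intro nn_integral_suminf) measurable
    also have "\<dots> \<le> (\<Sum>n. ennreal ((1/2)^n))"
    proof (intro suminf_le)
      fix n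
      have "(\<integral>\<^sup>+x. ?D n x \<partial>M) = ennreal (2^n) * (\<integral>\<^sup>+x. ennreal ((cmod (f (Suc n) x - f n x))\<^sup>2) \<partial>M)"
        by (subst nn_integral_cmult[symmetric]) (auto simp: ennreal_mult)
      also have "\<dots> \<le> ennreal (2^n) * ennreal ((1/4)^n)"
        by (intro mult_left_mono nn) auto
      also have "\<dots> = ennreal ((1/2)^n)"
        by (simp flip: ennreal_mult power_mult_distrib)
      finally show "(\<integral>\<^sup>+x. ?D n x \<partial>M) \<le> ennreal ((1/2)^n)" .
    qed auto
    also have "\<dots> = ennreal 2"
      using geometric_sums[of "1/2::real"] by (intro suminf_ennreal_eq) auto
    finally have "(\<integral>\<^sup>+x. (\<Sum>n. ?D n x) \<partial>M) \<noteq> \<infinity>" by (auto simp: top_unique)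
    then have AE_fin: "AE x in M. (\<Sum>n. ?D n x) \<noteq> \<infinity>"
      by (intro nn_integral_PInf_AE) auto
    have "convergent (\<lambda>n. f n x)" if fin: "(\<Sum>n. ?D n x) \<noteq> \<infinity>" for x
    proof -
      define C where "C = enn2real (\<Sum>n. ?D n x)"
      have C: "C \<ge> 0" "(\<Sum>n. ?D n x) = ennreal C"
        unfolding C_def using fin by (simp_all add: less_top)
      have D: "2^n * (cmod (f (Suc n) x - f n x))\<^sup>2 \<le> C" for n
      proof -
        have "sum (\<lambda>n. ?D n x) {n} \<le> (\<Sum>n. ?D n x)"
          by (rule sum_le_suminf) auto
        then have "?D n x \<le> ennreal C" unfolding C(2) by (simp only: sum.insert sum.empty finite.emptyI empty_iff simp_thms add_0_right)
        then show ?thesis using C(1) by (simp only: ennreal_le_iff)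
      qed
      have D_le: "cmod (f (Suc n) x - f n x) \<le> sqrt C * (1 / sqrt 2)^n" for n
      proof -
        have "(cmod (f (Suc n) x - f n x))\<^sup>2 \<le> C * (1/2)^n"
          using D[of n] by (simp add: field_simps)
        then have "cmod (f (Suc n) x - f n x) \<le> sqrt (C * (1/2)^n)"
          by (rule real_le_rsqrt)
        then show ?thesis by (simp add: real_sqrt_mult real_sqrt_power real_sqrt_divide)
      qed
      have D_sum: "summable (\<lambda>n. sqrt C * (1 / sqrt 2)^n)"
        by (intro summable_mult summable_geometric) simp
      have "summable (\<lambda>n. f (Suc n) x - f n x)"
        by (rule summable_comparison_test'[OF D_sum, of 0]) (rule D_le)
      then have "convergent (\<lambda>n. \<Sum>k<n. f (Suc k) x - f k x)"
        by (simp add: summable_iff_convergent)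
      then have "convergent (\<lambda>n. f n x - f 0 x)"
        by (simp only: sum_lessThan_telescope[of "\<lambda>k. f k x"])
      then show ?thesis
        using convergent_add[OF _ convergent_const[of "f 0 x"], of "\<lambda>n. f n x - f 0 x"] by simp
    qed
    then show ?thesis using AE_fin by (auto elim: eventually_mono)
  qed
  define g where "g x = lim (\<lambda>n. f n x)" for x
  have [measurable]: "g \<in> borel_measurable M"
    unfolding g_def by measurable
  have le: "(\<integral>\<^sup>+x. ennreal ((cmod (g x - f n x))\<^sup>2) \<partial>M) \<le> ennreal ((1/4)^n)" for n
  proof -
    have "(\<integral>\<^sup>+x. ennreal ((cmod (g x - f n x))\<^sup>2) \<partial>M)
        = (\<integral>\<^sup>+x. liminf (\<lambda>m. ennreal ((cmod (f m x - f n x))\<^sup>2)) \<partial>M)"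
    proof (intro nn_integral_cong_AE, use AE_conv in eventually_elim)
      fix x assume "convergent (\<lambda>n. f n x)"
      then have "(\<lambda>m. f m x) \<longlonglongrightarrow> g x" by (simp add: g_def convergent_LIMSEQ_iff)
      then have "(\<lambda>m. ennreal ((cmod (f m x - f n x))\<^sup>2)) \<longlonglongrightarrow> ennreal ((cmod (g x - f n x))\<^sup>2)"
        by (intro tendsto_intros)
      then show "ennreal ((cmod (g x - f n x))\<^sup>2) = liminf (\<lambda>m. ennreal ((cmod (f m x - f n x))\<^sup>2))"
        by (intro lim_imp_Liminf[symmetric]) auto
    qed
    also have "\<dots> \<le> liminf (\<lambda>m. \<integral>\<^sup>+x. ennreal ((cmod (f m x - f n x))\<^sup>2) \<partial>M)"
      by (intro nn_integral_liminf) measurable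
    also have "\<dots> \<le> liminf (\<lambda>m. ennreal ((1/4)^n))"
      using nn by (intro Liminf_mono eventually_sequentiallyI[of n]) auto
    also have "\<dots> = ennreal ((1/4)^n)" by (simp add: Liminf_const)
    finally show ?thesis .
  qed
  have int: "integrable M (\<lambda>x. (cmod (g x - f n x))\<^sup>2)" for n
    using le_less_trans[OF le[of n] ennreal_less_top] by (intro integrableI_bounded) auto
  have "L2 M (\<lambda>x. (g x - f 0 x) + f 0 x)"
    using int[of 0] by (intro L2_add f) (auto simp: L2_def)
  then have "L2 M g" by simp
  moreover have "(LINT x|M. (cmod (g x - f n x))\<^sup>2) \<le> (1/4)^n" for n
    using le[of n] by (subst (asm) nn_integral_eq_integral[OF int]) auto
  ultimately show ?thesis by blast
qed

section \<open>Orthonormal bases, Parseval, and the trace of a sum of rank-one operators\<close>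

lemma onb_L2: "onb M B \<Longrightarrow> f \<in> B \<Longrightarrow> L2 M f"
  by (auto simp: onb_def)

text \<open>\<open>onb\<close> demands maximality rather than a dense span, so completeness is used.
  Finite expansions of \<open>a\<close> whose mass comes within 4^-n of the supremum S converge to
  some g; a - g is orthogonal to \<open>B\<close>, hence null, and no mass is lost.\<close>

lemma Parseval:
  assumes B: "onb M B" and a: "L2 M a"
  shows "((\<lambda>f. (cmod (l2_inner M a f))\<^sup>2) has_sum (LINT x|M. (cmod (a x))\<^sup>2)) B"
proof -
  let ?s = "\<lambda>f. (cmod (l2_inner M a f))\<^sup>2"
  have ons: "l2.orthonormal_set M B" using B by (auto simp: onb_def l2.orthonormal_set_def)
  have on: "\<And>f g. f \<in> B \<Longrightarrow> g \<in> B \<Longrightarrow> l2_inner M f g = (if f = g then 1 else 0)"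
    using B by (auto simp: onb_def)
  note bessel = l2.Bessel[OF ons _ _ a] and pin = l2.proj_in[OF ons _ a]
    and presid = l2.proj_residual[OF ons _ _ a] and bp = l2.b_proj[OF ons _ _ _ a]
    and pp = l2.b_proj_proj[OF ons _ _ a]
  have na: "Re (l2_inner M a a) = (LINT x|M. (cmod (a x))\<^sup>2)" by (simp add: l2_inner_self a)
  have summ: "?s summable_on B"
    by (rule nonneg_bdd_above_summable_on) (auto intro!: bdd_aboveI2 bessel)
  define S where "S = infsum ?s B"
  have hs: "(?s has_sum S) B" using summ by (simp add: S_def)
  have "\<exists>X. finite X \<and> X \<subseteq> B \<and> (\<forall>Y. finite Y \<and> X \<subseteq> Y \<and> Y \<subseteq> B \<longrightarrow> S - (1/4)^n < sum ?s Y)" for n :: nat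
  proof -
    have "\<forall>\<^sub>F Y in finite_subsets_at_top B. S - (1/4)^n < sum ?s Y"
      using hs unfolding has_sum_def by (rule order_tendstoD) simp
    then show ?thesis by (auto simp: eventually_finite_subsets_at_top)
  qed
  then obtain X where X: "\<And>n. finite (X n)" "\<And>n. X n \<subseteq> B"
    "\<And>n Y. finite Y \<Longrightarrow> X n \<subseteq> Y \<Longrightarrow> Y \<subseteq> B \<Longrightarrow> S - (1/4)^n < sum ?s Y"
    by metis
  \<comment> \<open>Unions make the sets increase, so that differences of the expansions are
    themselves expansions over F m - F n.\<close>
  define F where "F n = (\<Union>i\<le>n. X i)" for n
  have F: "finite (F n)" "F n \<subseteq> B" "S - (1/4)^n < sum ?s (F n)" for n
    using X by (auto simp: F_def intro!: X(3))
  have Fm: "F n \<subseteq> F m" if "n \<le> m" for n m using that by (force simp: F_def)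
  have le_S: "sum ?s Y \<le> S" if "finite Y" "Y \<subseteq> B" for Y
    unfolding S_def using that summ by (intro finite_sum_le_infsum) auto
  define s where "s n = l2.proj M (F n) a" for n
  have sL: "L2 M (s n)" for n unfolding s_def using F by (intro pin) auto
  have "(LINT x|M. (cmod (s m x - s n x))\<^sup>2) \<le> (1/4)^n" if "n \<le> m" for m n
  proof -
    have d: "F m - F n \<subseteq> B" "finite (F m - F n)" using F by auto
    have "s m - s n = l2.proj M (F m - F n) a"
      unfolding s_def using Fm[OF that] F by (intro l2.proj_diff) auto
    then have "Re (l2_inner M (s m - s n) (s m - s n)) = sum ?s (F m - F n)"
      using pp[OF d] by (simp del: of_real_sum)
    also have "\<dots> = sum ?s (F m) - sum ?s (F n)"
      using Fm[OF that] F by (intro sum_diff) auto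
    also have "\<dots> \<le> (1/4)^n" using le_S[of "F m"] F[of m] F(3)[of n] by linarith
    finally show ?thesis
      using l2_inner_self[OF L2_diff[OF sL sL], of m n] by (simp add: fun_diff_def)
  qed
  from L2_fast_Cauchy_converges[OF sL this]
  obtain g where g: "L2 M g" and gs: "\<And>n. (LINT x|M. (cmod (g x - s n x))\<^sup>2) \<le> (1/4)^n" by blast
  have ngs: "l2_norm M (g - s n) \<le> (1/2)^n" for n
  proof (rule power2_le_imp_le)
    show "(l2_norm M (g - s n))\<^sup>2 \<le> ((1/2)^n)\<^sup>2"
      using gs[of n] l2_norm_sq[OF L2_diff[OF g sL], of n]
      by (simp add: fun_diff_def power_even_eq power_mult[symmetric] mult.commute[of n] power_mult power_divide)
  qed simp
  have "l2_inner M (a - g) f = 0" if f: "f \<in> B" for f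
  proof -
    have fL: "L2 M f" using f B by (auto simp: onb_def)
    have nf: "l2_norm M f = 1" using on[OF f f] by (simp add: l2.nrm_def)
    have 1: "cmod (l2_inner M (a - s n) f) \<le> (1/2)^n" for n
    proof (cases "f \<in> F n")
      case True
      then show ?thesis using bp[OF F(2,1) f, of n] a fL sL by (simp add: l2.b_diff s_def)
    next
      case False
      \<comment> \<open>An f outside F n can carry only the mass still missing, at most
        4^-n.\<close>
      have "sum ?s (insert f (F n)) \<le> S" using F f by (intro le_S) auto
      then have "?s f \<le> (1/4)^n" using F(1,3)[of n] False by simp
      then have "(cmod (l2_inner M a f))\<^sup>2 \<le> ((1/2)^n)\<^sup>2"
        by (simp add: power_mult[symmetric] mult.commute[of n] power_mult power_divide)
      then have "cmod (l2_inner M a f) \<le> (1/2)^n" by (rule power2_le_imp_le) simp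
      then show ?thesis using False bp[OF F(2,1) f, of n] a fL sL by (simp add: l2.b_diff s_def)
    qed
    have 2: "cmod (l2_inner M (g - s n) f) \<le> (1/2)^n" for n
      using l2.b_le_nrm[of M "g - s n" f] ngs[of n] g sL fL nf by simp
    have "l2_inner M (a - g) f = l2_inner M (a - s n) f - l2_inner M (g - s n) f" for n
      using a g sL fL by (simp add: l2.b_diff)
    then have 3: "cmod (l2_inner M (a - g) f) \<le> 2 * (1/2)^n" for n
      using norm_triangle_ineq4[of "l2_inner M (a - s n) f" "l2_inner M (g - s n) f"] 1[of n] 2[of n]
      by simp
    have "(\<lambda>n. 2 * (1/2::real)^n) \<longlonglongrightarrow> 0"
      by (intro tendsto_mult_right_zero LIMSEQ_realpow_zero) auto
    then have "cmod (l2_inner M (a - g) f) \<le> 0"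
      by (rule LIMSEQ_le_const) (use 3 in blast)
    then show ?thesis by simp
  qed
  then have "AE x in M. (a - g) x = 0"
    using B l2.V_diff[OF a g] unfolding onb_def by blast
  then have ag: "AE x in M. a x = g x" by simp
  have "(LINT x|M. (cmod (a x))\<^sup>2) \<le> S + (1/4)^n" for n
  proof -
    have [measurable]: "a \<in> borel_measurable M" "g \<in> borel_measurable M" "s n \<in> borel_measurable M"
      using a g sL by (auto simp: L2_def)
    have "Re (l2_inner M a a) - sum ?s (F n) = Re (l2_inner M (a - s n) (a - s n))"
      unfolding s_def using presid F by simp
    also have "\<dots> = (LINT x|M. (cmod (a x - s n x))\<^sup>2)"
      using l2_inner_self[OF L2_diff[OF a sL], of n] by (simp add: fun_diff_def)
    also have "\<dots> = (LINT x|M. (cmod (g x - s n x))\<^sup>2)"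
      using ag by (intro integral_cong_AE) auto
    also have "\<dots> \<le> (1/4)^n" by (rule gs)
    finally show ?thesis using le_S[of "F n"] F[of n] na by simp
  qed
  moreover have "(\<lambda>n. S + (1/4::real)^n) \<longlonglongrightarrow> S + 0"
    by (intro tendsto_intros LIMSEQ_realpow_zero) auto
  ultimately have "(LINT x|M. (cmod (a x))\<^sup>2) \<le> S + 0" by (intro LIMSEQ_le_const) auto
  moreover have "S \<le> (LINT x|M. (cmod (a x))\<^sup>2)"
    unfolding S_def na[symmetric] using summ by (intro infsum_le_finite_sums bessel) auto
  ultimately show ?thesis using hs by simp
qed

text \<open>Polarisation of \<open>Parseval\<close>; the vectors a + i c and a - i c supply the
  imaginary part.\<close>

lemma Parseval_inner:
  assumes B: "onb M B" and a: "L2 M a" and c: "L2 M c"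
  shows "((\<lambda>f. l2_inner M a f * l2_inner M f c) has_sum l2_inner M a c) B"
proof -
  let ?N = "\<lambda>h. complex_of_real (LINT x|M. (cmod (h x))\<^sup>2)"
  have P: "((\<lambda>f. complex_of_real ((cmod (l2_inner M h f))\<^sup>2)) has_sum ?N h) B" if "L2 M h" for h
    using has_sum_of_real[OF Parseval[OF B that]] .
  define ic where "ic = (\<lambda>x. \<i> * c x)"
  have ic: "L2 M ic" unfolding ic_def using c by (rule L2_scale)
  have icr: "l2_inner M g ic = - \<i> * l2_inner M g c" "l2_inner M ic g = \<i> * l2_inner M c g" if "L2 M g" for g
    unfolding ic_def using that c by (simp_all add: l2.b_scl l2.b_scl_right)
  have N: "?N h = l2_inner M h h" if "L2 M h" for h using l2_inner_self[OF that] by simp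
  define q where "q f = (complex_of_real ((cmod (l2_inner M (a + c) f))\<^sup>2)
      + (-1) * complex_of_real ((cmod (l2_inner M (a - c) f))\<^sup>2)
      + \<i> * complex_of_real ((cmod (l2_inner M (a + ic) f))\<^sup>2)
      + (-\<i>) * complex_of_real ((cmod (l2_inner M (a - ic) f))\<^sup>2)) / 4" for f
  have "(q has_sum ((?N (a + c) + (-1) * ?N (a - c) + \<i> * ?N (a + ic) + (-\<i>) * ?N (a - ic)) / 4)) B"
    unfolding q_def divide_inverse using a c ic
    by (intro has_sum_cmult_left has_sum_add has_sum_cmult_right P) simp_all
  also have "(?N (a + c) + (-1) * ?N (a - c) + \<i> * ?N (a + ic) + (-\<i>) * ?N (a - ic)) / 4 = l2_inner M a c"
    unfolding N[OF l2.V_add[OF a c]] N[OF l2.V_diff[OF a c]] N[OF l2.V_add[OF a ic]] N[OF l2.V_diff[OF a ic]]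
    using a c ic by (simp add: l2.b_add l2.b_diff l2.b_add_right l2.b_diff_right icr algebra_simps)
  finally have "(q has_sum l2_inner M a c) B" .
  moreover have "q f = l2_inner M a f * l2_inner M f c" if "f \<in> B" for f
  proof -
    have f: "L2 M f" using that by (rule onb_L2[OF B])
    have "l2_inner M f c = cnj (l2_inner M c f)" using f c by (intro l2.b_herm)
    then show ?thesis
      unfolding q_def complex_norm_square using a c ic f
      by (simp add: l2.b_add l2.b_diff icr algebra_simps)
  qed
  ultimately show ?thesis
    using has_sum_cong[of B q "\<lambda>f. l2_inner M a f * l2_inner M f c"] by simp
qed

text \<open>With T f = sum_k <f, c_k> a_k and t f = <T f, f> this is the trace of T in an arbitrary
  basis. The double family over k and \<open>B\<close> is absolutely summable, because |x y| <= x^2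
  + y^2 and Parseval controls both square sums, so the order of summation may be exchanged.\<close>

lemma has_sum_trace:
  assumes B: "onb M B" and a: "\<And>k::nat. L2 M (a k)" and c: "\<And>k. L2 M (c k)"
    and sa: "(\<lambda>k. (l2_norm M (a k))\<^sup>2) summable_on UNIV" and sc: "(\<lambda>k. (l2_norm M (c k))\<^sup>2) summable_on UNIV"
    and T: "\<And>f. f \<in> B \<Longrightarrow> ((\<lambda>k. l2_inner M f (c k) * l2_inner M (a k) f) has_sum t f) UNIV"
  shows "(t has_sum (\<Sum>\<^sub>\<infinity>k. l2_inner M (a k) (c k))) B"
proof -
  let ?F = "\<lambda>(k::nat, f). l2_inner M (a k) f * l2_inner M f (c k)"
  have "(\<lambda>z. norm (?F z)) summable_on (UNIV \<times> B)"
  proof (rule summable_on_comparison_test)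
    let ?G = "\<lambda>(k::nat, f). (cmod (l2_inner M (a k) f))\<^sup>2 + (cmod (l2_inner M (c k) f))\<^sup>2"
    show "?G summable_on (UNIV \<times> B)"
    proof (rule summable_on_SigmaI)
      fix k
      show "((\<lambda>f. ?G (k, f)) has_sum ((l2_norm M (a k))\<^sup>2 + (l2_norm M (c k))\<^sup>2)) B"
        using has_sum_add[OF Parseval[OF B a[of k]] Parseval[OF B c[of k]]]
        by (simp add: l2_norm_sq a c)
    qed (auto intro: summable_on_add sa sc)
    fix z :: "nat \<times> ('a \<Rightarrow> complex)" assume "z \<in> UNIV \<times> B"
    then obtain k f where z: "z = (k, f)" "f \<in> B" by auto
    have f: "L2 M f" using z by (auto intro: onb_L2[OF B])
    have "cmod (l2_inner M f (c k)) = cmod (l2_inner M (c k) f)"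
      using l2.b_herm[OF c[of k] f] by simp
    then show "norm (?F z) \<le> ?G z"
      unfolding z by (simp add: norm_mult mult_le_sum_squares)
  qed auto
  then have "?F summable_on (UNIV \<times> B)" by (rule abs_summable_summable)
  then obtain s where s: "(?F has_sum s) (UNIV \<times> B)" by (auto simp: summable_on_def)
  have "((\<lambda>k. l2_inner M (a k) (c k)) has_sum s) UNIV"
    using s by (rule has_sum_SigmaD) (auto intro!: Parseval_inner B a c)
  then have "s = (\<Sum>\<^sub>\<infinity>k. l2_inner M (a k) (c k))" by (simp add: infsumI)
  moreover have "((\<lambda>(f, k). ?F (k, f)) has_sum s) (B \<times> UNIV)"
    using s by (subst (asm) has_sum_swap) (simp add: case_prod_unfold)
  then have "(t has_sum s) B"
    by (rule has_sum_SigmaD) (use T in \<open>auto simp: mult.commute\<close>)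
  ultimately show ?thesis by simp
qed

lemma onb_approx:
  assumes B: "onb M B" and f: "L2 M f" and "\<epsilon> > 0"
  shows "\<exists>F. finite F \<and> F \<subseteq> B \<and> l2_norm M (f - l2.proj M F f) < \<epsilon>"
proof -
  have ons: "l2.orthonormal_set M B" using B by (auto simp: onb_def l2.orthonormal_set_def)
  have "\<forall>\<^sub>F F in finite_subsets_at_top B. (LINT x|M. (cmod (f x))\<^sup>2) - \<epsilon>\<^sup>2 < (\<Sum>g\<in>F. (cmod (l2_inner M f g))\<^sup>2)"
    using Parseval[OF B f] unfolding has_sum_def by (rule order_tendstoD) (use \<open>\<epsilon> > 0\<close> in simp)
  then obtain F where F: "finite F" "F \<subseteq> B"
    "(LINT x|M. (cmod (f x))\<^sup>2) - \<epsilon>\<^sup>2 < (\<Sum>g\<in>F. (cmod (l2_inner M f g))\<^sup>2)"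
    by (auto simp: eventually_finite_subsets_at_top)
  have "L2 M (f - l2.proj M F f)" using l2.proj_in[OF ons F(2) f] f by simp
  then have "(l2_norm M (f - l2.proj M F f))\<^sup>2 < \<epsilon>\<^sup>2"
    using l2.proj_residual[OF ons F(2,1) f] F(3) l2_inner_self[OF f] by (simp add: l2.nrm_sq)
  then show ?thesis using F \<open>\<epsilon> > 0\<close> by (intro exI[of _ F]) (auto intro: power2_less_imp_less)
qed

text \<open>Removing 0 discards the indices at which \<open>e\<close> added nothing new. A vector
  orthogonal to the rest is orthogonal to every \<open>e k\<close>, because the remainder of
  \<open>e k\<close> at stage k + 1 is null.\<close>

lemma onb_range_gram_schmidt:
  assumes e: "\<And>k. L2 M (e k)"
    and total: "\<And>u. L2 M u \<Longrightarrow> (\<And>k. l2_inner M u (e k) = 0) \<Longrightarrow> AE x in M. u x = 0"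
  shows "onb M (range (l2.gram_schmidt M e) - {0})"
proof -
  let ?h = "l2.gram_schmidt M e"
  have wo: "l2.weak_orthonormal M ?h" by (rule l2.weak_orthonormal_gram_schmidt[OF e])
  have hL: "L2 M (?h k)" for k by (rule l2.wo_in[OF wo])
  show ?thesis
    unfolding onb_def
  proof (intro conjI ballI allI impI)
    fix f assume "f \<in> range ?h - {0}"
    then show "L2 M f" using hL by auto
  next
    fix f g assume "f \<in> range ?h - {0}" "g \<in> range ?h - {0}"
    then obtain j k where jk: "f = ?h j" "g = ?h k" "?h j \<noteq> 0" "?h k \<noteq> 0" by auto
    show "l2_inner M f g = (if f = g then 1 else 0)"
      using wo jk unfolding l2.weak_orthonormal_def by (cases "f = g") (simp, metis+)
  next
    fix u assume u: "L2 M u \<and> (\<forall>f\<in>range ?h - {0}. l2_inner M u f = 0)"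
    have hu: "l2_inner M (?h k) u = 0" for k
    proof (cases "?h k = 0")
      case False
      then show ?thesis using u l2.b_orth_sym[of M u "?h k"] hL by auto
    qed (use u in simp)
    have "l2_inner M u (e k) = 0" for k
    proof -
      have "l2_inner M (l2.resid M ?h (Suc k) (e k)) u = 0"
        using u by (intro l2.resid_null_inner[OF wo e] l2.resid_gram_schmidt[OF e]) auto
      then have "l2_inner M (e k) u = 0"
        using l2.resid_inner[OF wo e, of u "Suc k" k] u hu by simp
      then show ?thesis using l2.b_orth_sym[OF e] u by blast
    qed
    then show "AE x in M. u x = 0" using total u by blast
  qed
qed

section \<open>Refining partitions\<close>

text \<open>This is what the convergence proof uses of the topology. A partition may contain the
  empty set: uniqueness is demanded only of the cell through a point.\<close>

locale refining_partitions = sigma_finite_measure M for M :: "'a measure" +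
  fixes P :: "nat \<Rightarrow> 'a set set"
  assumes space_UNIV [simp]: "space M = UNIV"
    and countable_P: "countable (P n)"
    and P_sets: "C \<in> P n \<Longrightarrow> C \<in> sets M"
    and P_finite: "C \<in> P n \<Longrightarrow> emeasure M C < \<infinity>"
    and P_partition: "\<exists>!C. C \<in> P n \<and> x \<in> C"
    and P_refines: "D \<in> P (Suc n) \<Longrightarrow> \<exists>C\<in>P n. D \<subseteq> C"
    and P_generates: "sets M = sigma_sets UNIV (\<Union>n. P n)"
begin

definition atom :: "nat \<Rightarrow> 'a \<Rightarrow> 'a set" where "atom n x = (THE B. B \<in> P n \<and> x \<in> B)"

definition null_part :: "'a set" where "null_part = {x. \<exists>m. emeasure M (atom m x) = 0}"

lemma atom_in: "atom n x \<in> P n" and mem_atom: "x \<in> atom n x"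
  using theI'[OF P_partition[of n x]] by (auto simp: atom_def)

lemma atom_eq: "C \<in> P n \<Longrightarrow> x \<in> C \<Longrightarrow> atom n x = C"
  using P_partition[of n x] atom_in[of n x] mem_atom[of x n] by blast

lemma atom_cong: "y \<in> atom n x \<Longrightarrow> atom n y = atom n x"
  by (rule atom_eq[OF atom_in])

lemma P_disjoint: "C \<in> P n \<Longrightarrow> D \<in> P n \<Longrightarrow> C \<noteq> D \<Longrightarrow> C \<inter> D = {}"
  using atom_eq by blast

lemma P_refines_le: "m \<le> n \<Longrightarrow> D \<in> P n \<Longrightarrow> \<exists>C\<in>P m. D \<subseteq> C"
proof (induction n arbitrary: D rule: dec_induct)
  case (step n)
  then show ?case using P_refines[of D n] by (meson subset_trans)
qed auto

lemma P_nested: "m \<le> n \<Longrightarrow> C \<in> P m \<Longrightarrow> D \<in> P n \<Longrightarrow> D \<subseteq> C \<or> C \<inter> D = {}"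
  using P_refines_le[of m n D] P_disjoint[of C m] by blast

lemma atom_sets [measurable]: "atom n x \<in> sets M"
  by (rule P_sets[OF atom_in])

lemma atom_finite: "emeasure M (atom n x) < \<infinity>"
  by (rule P_finite[OF atom_in])

text \<open>A preimage is a union of countably many cells.\<close>

lemma borel_measurable_cellwise: "(\<lambda>x. g (atom n x)) \<in> measurable M N" if "range (\<lambda>x. g (atom n x)) \<subseteq> space N"
proof (rule measurableI)
  fix A assume "A \<in> sets N"
  have "(\<lambda>x. g (atom n x)) -` A \<inter> space M = \<Union> {C \<in> P n. g C \<in> A}"
    using atom_in mem_atom atom_eq by fastforce
  also have "\<dots> \<in> sets M"
    using countable_P[of n] by (intro sets.countable_Union) (auto intro: P_sets countable_subset)
  finally show "(\<lambda>x. g (atom n x)) -` A \<inter> space M \<in> sets M" .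
qed (use that in auto)

lemma null_sets_null_part: "null_part \<in> null_sets M"
proof -
  have "null_part = (\<Union>m. \<Union>{C \<in> P m. emeasure M C = 0})"
    unfolding null_part_def using atom_in mem_atom atom_eq by fastforce
  moreover have "\<Union>{C \<in> P m. emeasure M C = 0} \<in> null_sets M" for m
    using countable_P[of m] null_sets_UN'[of "{C \<in> P m. emeasure M C = 0}" "\<lambda>C. C" M]
    by (auto intro: P_sets countable_subset)
  ultimately show ?thesis by (simp add: null_sets_UN)
qed

lemma null_part_sets [measurable]: "null_part \<in> sets M"
  using null_sets_null_part by auto

lemma AE_not_null: "AE x in M. x \<notin> null_part"
  by (rule AE_not_in[OF null_sets_null_part])

lemma measure_atom_pos: "x \<notin> null_part \<Longrightarrow> measure M (atom n x) > 0"
  using atom_finite[of n x] by (auto simp: null_part_def measure_def enn2real_positive_iff zero_less_iff_neq_zero)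

text \<open>The integral kernel of averaging over cells. Membership in \<open>null_part\<close>
  depends on all levels and can differ inside one cell of level n, so both points are tested; this
  makes the kernel symmetric everywhere.\<close>

definition weight :: "nat \<Rightarrow> 'a \<Rightarrow> 'a \<Rightarrow> real" where
  "weight n x y = (if x \<in> null_part \<or> y \<in> null_part then 0 else indicator (atom n x) y / measure M (atom n x))"

lemma weight_sym: "weight n x y = weight n y x"
proof (cases "y \<in> atom n x")
  case True
  then show ?thesis using mem_atom[of x n] atom_cong[OF True] by (auto simp: weight_def)
next
  case False
  then have "x \<notin> atom n y" using mem_atom[of y n] atom_cong[of x n y] by auto
  then show ?thesis using False by (simp add: weight_def)
qed

lemma weight_nonneg [simp]: "0 \<le> weight n x y"
  by (auto simp: weight_def)

lemma weight_measurable [measurable]: "(\<lambda>z. weight n (fst z) (snd z)) \<in> borel_measurable (M \<Otimes>\<^sub>M M)"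
proof -
  have "{z. snd z \<in> atom n (fst z)} = (\<Union>C\<in>P n. C \<times> C)"
    using atom_in mem_atom atom_eq by fastforce
  moreover have "(\<Union>C\<in>P n. C \<times> C) \<in> sets (M \<Otimes>\<^sub>M M)"
    using countable_P by (intro sets.countable_UN'') (auto intro: P_sets)
  ultimately have [measurable]: "{z. snd z \<in> atom n (fst z)} \<in> sets (M \<Otimes>\<^sub>M M)" by simp
  have [measurable]: "(\<lambda>x. measure M (atom n x)) \<in> borel_measurable M"
    by (rule borel_measurable_cellwise) simp
  have "(\<lambda>z. weight n (fst z) (snd z)) = (\<lambda>z. if fst z \<in> null_part \<or> snd z \<in> null_part then 0
      else indicator {z. snd z \<in> atom n (fst z)} z / measure M (atom n (fst z)))"
    by (auto simp: weight_def fun_eq_iff indicator_def)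
  also have "\<dots> \<in> borel_measurable (M \<Otimes>\<^sub>M M)" by measurable
  finally show ?thesis .
qed

lemma weight_measurable1 [measurable]: "weight n x \<in> borel_measurable M"
  unfolding weight_def by measurable

lemma nn_integral_weight: "(\<integral>\<^sup>+y. ennreal (weight n x y) \<partial>M) \<le> 1"
proof (cases "x \<in> null_part")
  case False
  have "(\<integral>\<^sup>+y. ennreal (weight n x y) \<partial>M) \<le> (\<integral>\<^sup>+y. ennreal (1 / measure M (atom n x)) * indicator (atom n x) y \<partial>M)"
    by (intro nn_integral_mono) (auto simp: weight_def indicator_def)
  also have "\<dots> = ennreal (1 / measure M (atom n x)) * ennreal (measure M (atom n x))"
    using atom_finite[of n x] by (subst nn_integral_cmult_indicator) (auto simp: emeasure_eq_ennreal_measure)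
  also have "\<dots> = 1" using measure_atom_pos[OF False, of n] by (simp flip: ennreal_mult)
  finally show ?thesis .
qed (simp add: weight_def)

sublocale pair: pair_sigma_finite M M ..

text \<open>A Schur test: the kernel has mass at most 1 in one variable, and by symmetry in the
  other.\<close>

lemma nn_integral_weight_le:
  assumes [measurable]: "u \<in> borel_measurable M"
  shows "(\<integral>\<^sup>+x. \<integral>\<^sup>+y. ennreal (weight n x y) * u y \<partial>M \<partial>M) \<le> (\<integral>\<^sup>+y. u y \<partial>M)"
    and "(\<integral>\<^sup>+x. \<integral>\<^sup>+y. ennreal (weight n x y) * u x \<partial>M \<partial>M) \<le> (\<integral>\<^sup>+x. u x \<partial>M)"
proof -
  have 1: "(\<integral>\<^sup>+y. ennreal (weight n x y) * u x \<partial>M) \<le> u x" for x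
    using mult_right_mono[OF nn_integral_weight[of n x], of "u x"] by (subst nn_integral_multc) auto
  then show "(\<integral>\<^sup>+x. \<integral>\<^sup>+y. ennreal (weight n x y) * u x \<partial>M \<partial>M) \<le> (\<integral>\<^sup>+x. u x \<partial>M)"
    by (intro nn_integral_mono)
  have "(\<integral>\<^sup>+x. \<integral>\<^sup>+y. ennreal (weight n x y) * u y \<partial>M \<partial>M) = (\<integral>\<^sup>+y. \<integral>\<^sup>+x. ennreal (weight n x y) * u y \<partial>M \<partial>M)"
    by (rule pair.Fubini'[symmetric]) (simp add: case_prod_unfold)
  also have "\<dots> = (\<integral>\<^sup>+y. \<integral>\<^sup>+x. ennreal (weight n y x) * u y \<partial>M \<partial>M)"
    by (subst weight_sym) simp
  also have "\<dots> \<le> (\<integral>\<^sup>+y. u y \<partial>M)"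
    using 1 by (intro nn_integral_mono)
  finally show "(\<integral>\<^sup>+x. \<integral>\<^sup>+y. ennreal (weight n x y) * u y \<partial>M \<partial>M) \<le> (\<integral>\<^sup>+y. u y \<partial>M)" .
qed

section \<open>Conditional expectation on the cells of level n: contraction and symmetry\<close>

definition cond_mean :: "nat \<Rightarrow> ('a \<Rightarrow> complex) \<Rightarrow> 'a \<Rightarrow> complex" where
  "cond_mean n f x = (if x \<in> null_part then 0
     else set_lebesgue_integral M (atom n x) f / complex_of_real (measure M (atom n x)))"

lemma cond_mean_kernel:
  assumes [measurable]: "f \<in> borel_measurable M"
  shows "cond_mean n f x = (LINT y|M. complex_of_real (weight n x y) * f y)"
proof (cases "x \<in> null_part")
  case False
  have "(LINT y|M. complex_of_real (weight n x y) * f y)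
      = (LINT y|M. (indicator (atom n x) y *\<^sub>R f y) / complex_of_real (measure M (atom n x)))"
  proof (rule integral_cong_AE)
    show "AE y in M. complex_of_real (weight n x y) * f y
      = indicat_real (atom n x) y *\<^sub>R f y / complex_of_real (measure M (atom n x))"
      using AE_not_null by eventually_elim (use False in \<open>auto simp: weight_def indicator_def\<close>)
  qed measurable
  then show ?thesis using False by (simp add: cond_mean_def set_lebesgue_integral_def)
qed (simp add: cond_mean_def weight_def)

lemma cond_mean_measurable [measurable]: "cond_mean n f \<in> borel_measurable M"
proof -
  have [measurable]: "(\<lambda>x. (\<lambda>C. set_lebesgue_integral M C f / complex_of_real (measure M C)) (atom n x)) \<in> borel_measurable M"
    by (rule borel_measurable_cellwise) simp
  then show ?thesis unfolding cond_mean_def by measurable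
qed

lemma L2_indicator_finite:
  assumes "A \<in> sets M" "emeasure M A < \<infinity>" shows "L2 M (indicator A)"
proof -
  have "(\<lambda>x. (cmod (indicator A x))\<^sup>2) = indicat_real A" by (auto simp: indicator_def)
  then show ?thesis using assms by (simp add: L2_def)
qed

lemma L2_indicator_mult:
  assumes "L2 M f" "A \<in> sets M" shows "L2 M (\<lambda>x. indicator A x * f x)"
  unfolding L2_def
proof
  have f [measurable]: "f \<in> borel_measurable M" "A \<in> sets M" using assms by (auto simp: L2_def)
  show "(\<lambda>x. indicator A x * f x) \<in> borel_measurable M" by measurable
  show "integrable M (\<lambda>x. (cmod (indicator A x * f x))\<^sup>2)"
  proof (rule Bochner_Integration.integrable_bound)
    show "integrable M (\<lambda>x. (cmod (f x))\<^sup>2)" using assms by (simp add: L2_def)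
  qed (auto simp: indicator_def)
qed

lemma L2_set_integrable:
  assumes "L2 M f" "A \<in> sets M" "emeasure M A < \<infinity>" shows "set_integrable M A f"
proof -
  have "(\<lambda>x. indicat_real A x *\<^sub>R f x) = (\<lambda>x. indicator A x * f x)" by (auto simp: indicator_def)
  then show ?thesis unfolding set_integrable_def
    using L2_mult_integrable[OF L2_indicator_finite[OF assms(2,3)] assms(1)] by simp
qed

text \<open>Jensen's inequality on one cell, obtained from Cauchy-Schwarz for the restriction of
  \<open>f\<close> to the cell and the indicator of the cell.\<close>

lemma cond_mean_sq_le:
  assumes f: "L2 M f"
  shows "ennreal ((cmod (cond_mean n f x))\<^sup>2) \<le> (\<integral>\<^sup>+y. ennreal (weight n x y) * ennreal ((cmod (f y))\<^sup>2) \<partial>M)"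
proof (cases "x \<in> null_part")
  case False
  have [measurable]: "f \<in> borel_measurable M" using f by (rule L2_measurable)
  let ?C = "atom n x" let ?m = "measure M (atom n x)"
  define u where "u = (\<lambda>y. indicator ?C y * f y)"
  define v :: "'a \<Rightarrow> complex" where "v = indicator ?C"
  have u: "L2 M u" unfolding u_def by (rule L2_indicator_mult[OF f atom_sets])
  have v: "L2 M v" unfolding v_def by (rule L2_indicator_finite[OF atom_sets atom_finite])
  have m: "?m > 0" by (rule measure_atom_pos[OF False])
  have "(LINT y|M. (cmod (v y))\<^sup>2) = (LINT y|M. indicat_real ?C y)"
    by (intro Bochner_Integration.integral_cong) (auto simp: v_def indicator_def)
  then have vv: "(LINT y|M. (cmod (v y))\<^sup>2) = ?m" by simp
  have "l2_inner M u v = set_lebesgue_integral M ?C f"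
    unfolding l2_inner_def set_lebesgue_integral_def u_def v_def
    by (intro Bochner_Integration.integral_cong) (auto simp: indicator_def)
  then have "(cmod (set_lebesgue_integral M ?C f))\<^sup>2 \<le> (LINT y|M. (cmod (u y))\<^sup>2) * ?m"
    using l2.Cauchy_Schwarz[OF u v] by (simp add: l2_inner_self u v vv)
  then have "(cmod (cond_mean n f x))\<^sup>2 \<le> (LINT y|M. (cmod (u y))\<^sup>2) / ?m"
    using False m by (simp add: cond_mean_def norm_divide power_divide field_simps power2_eq_square)
  then have "ennreal ((cmod (cond_mean n f x))\<^sup>2) \<le> ennreal (LINT y|M. (cmod (u y))\<^sup>2 / ?m)"
    by (simp add: ennreal_leI)
  also have "\<dots> = (\<integral>\<^sup>+y. ennreal ((cmod (u y))\<^sup>2 / ?m) \<partial>M)"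
    using u m by (intro nn_integral_eq_integral[symmetric]) (auto simp: L2_def)
  also have "\<dots> = (\<integral>\<^sup>+y. ennreal (weight n x y) * ennreal ((cmod (f y))\<^sup>2) \<partial>M)"
  proof (intro nn_integral_cong_AE, use AE_not_null in eventually_elim)
    fix y assume "y \<notin> null_part"
    then show "ennreal ((cmod (u y))\<^sup>2 / ?m) = ennreal (weight n x y) * ennreal ((cmod (f y))\<^sup>2)"
      using False m by (auto simp: u_def weight_def indicator_def simp flip: ennreal_mult)
  qed
  finally show ?thesis .
qed (simp add: cond_mean_def)

lemma cond_mean_contraction:
  assumes f: "L2 M f"
  shows L2_cond_mean: "L2 M (cond_mean n f)"
    and norm_cond_mean_le: "l2_norm M (cond_mean n f) \<le> l2_norm M f"
proof -
  have [measurable]: "f \<in> borel_measurable M" using f by (rule L2_measurable)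
  have "(\<integral>\<^sup>+x. ennreal ((cmod (cond_mean n f x))\<^sup>2) \<partial>M)
      \<le> (\<integral>\<^sup>+x. \<integral>\<^sup>+y. ennreal (weight n x y) * ennreal ((cmod (f y))\<^sup>2) \<partial>M \<partial>M)"
    by (intro nn_integral_mono cond_mean_sq_le f)
  also have "\<dots> \<le> (\<integral>\<^sup>+y. ennreal ((cmod (f y))\<^sup>2) \<partial>M)"
    by (rule nn_integral_weight_le) measurable
  also have "\<dots> = ennreal (LINT y|M. (cmod (f y))\<^sup>2)"
    using f by (intro nn_integral_eq_integral) (auto simp: L2_def)
  finally have le: "(\<integral>\<^sup>+x. ennreal ((cmod (cond_mean n f x))\<^sup>2) \<partial>M) \<le> ennreal (LINT y|M. (cmod (f y))\<^sup>2)" .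
  have int: "integrable M (\<lambda>x. (cmod (cond_mean n f x))\<^sup>2)"
    using le_less_trans[OF le ennreal_less_top] by (intro integrableI_bounded) auto
  then show L: "L2 M (cond_mean n f)" by (simp add: L2_def)
  have "(LINT y|M. (cmod (cond_mean n f y))\<^sup>2) \<le> (LINT y|M. (cmod (f y))\<^sup>2)"
    using le by (subst (asm) nn_integral_eq_integral[OF int]) auto
  then have "(l2_norm M (cond_mean n f))\<^sup>2 \<le> (l2_norm M f)\<^sup>2" by (simp only: l2_norm_sq L f)
  then show "l2_norm M (cond_mean n f) \<le> l2_norm M f"
    using f by (rule_tac power2_le_imp_le) auto
qed

text \<open>Symmetry of \<open>weight\<close> and Fubini, justified by |f y g x| <= |f y|^2 + |g
  x|^2 and the two Schur bounds. No conjugate appears, because \<open>int_op_avg\<close> pairs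
  functions bilinearly.\<close>

lemma cond_mean_sym:
  assumes f: "L2 M f" and g: "L2 M g"
  shows "(LINT x|M. cond_mean n f x * g x) = (LINT x|M. f x * cond_mean n g x)"
proof -
  have [measurable]: "f \<in> borel_measurable M" "g \<in> borel_measurable M"
    using f g by (auto intro: L2_measurable)
  let ?h = "\<lambda>x y. complex_of_real (weight n x y) * f y * g x"
  have "integrable (M \<Otimes>\<^sub>M M) (case_prod ?h)"
  proof (rule integrableI_bounded)
    show meas: "case_prod ?h \<in> borel_measurable (M \<Otimes>\<^sub>M M)"
      unfolding case_prod_unfold by measurable
    let ?F = "\<lambda>x. ennreal ((cmod (f x))\<^sup>2)" let ?G = "\<lambda>x. ennreal ((cmod (g x))\<^sup>2)"
    have fin: "(\<integral>\<^sup>+y. ?F y \<partial>M) < \<infinity>" "(\<integral>\<^sup>+y. ?G y \<partial>M) < \<infinity>"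
      using f g by (auto simp: L2_def nn_integral_eq_integral)
    have "(\<integral>\<^sup>+z. ennreal (norm (case_prod ?h z)) \<partial>(M \<Otimes>\<^sub>M M)) = (\<integral>\<^sup>+x. \<integral>\<^sup>+y. ennreal (norm (?h x y)) \<partial>M \<partial>M)"
      using meas by (subst nn_integral_fst[symmetric]) auto
    also have "\<dots> \<le> (\<integral>\<^sup>+x. \<integral>\<^sup>+y. (ennreal (weight n x y) * ?F y + ennreal (weight n x y) * ?G x) \<partial>M \<partial>M)"
    proof (intro nn_integral_mono)
      fix x y
      have "cmod (f y) * cmod (g x) \<le> (cmod (f y))\<^sup>2 + (cmod (g x))\<^sup>2"
        by (rule mult_le_sum_squares) auto
      then have "norm (?h x y) \<le> weight n x y * ((cmod (f y))\<^sup>2 + (cmod (g x))\<^sup>2)"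
        by (simp add: norm_mult mult.assoc mult_left_mono)
      then show "ennreal (norm (?h x y)) \<le> ennreal (weight n x y) * ?F y + ennreal (weight n x y) * ?G x"
        by (simp add: distrib_left ennreal_leI flip: ennreal_mult ennreal_plus)
    qed
    also have "\<dots> = (\<integral>\<^sup>+x. \<integral>\<^sup>+y. ennreal (weight n x y) * ?F y \<partial>M \<partial>M) + (\<integral>\<^sup>+x. \<integral>\<^sup>+y. ennreal (weight n x y) * ?G x \<partial>M \<partial>M)"
    proof -
      have [measurable]: "(\<lambda>x. \<integral>\<^sup>+y. ennreal (weight n x y) * ?F y \<partial>M) \<in> borel_measurable M"
        "(\<lambda>x. \<integral>\<^sup>+y. ennreal (weight n x y) * ?G x \<partial>M) \<in> borel_measurable M"
        by (auto intro!: borel_measurable_nn_integral simp: case_prod_unfold)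
      show ?thesis by (subst nn_integral_add[symmetric]) (auto simp: nn_integral_add)
    qed
    also have "\<dots> \<le> (\<integral>\<^sup>+y. ?F y \<partial>M) + (\<integral>\<^sup>+y. ?G y \<partial>M)"
      by (intro add_mono nn_integral_weight_le) auto
    also have "\<dots> < \<infinity>" using fin by simp
    finally show "(\<integral>\<^sup>+z. ennreal (norm (case_prod ?h z)) \<partial>(M \<Otimes>\<^sub>M M)) < \<infinity>" .
  qed
  from pair.Fubini_integral[OF this]
  have "(LINT y|M. LINT x|M. f y * (complex_of_real (weight n y x) * g x)) = (LINT x|M. LINT y|M. (complex_of_real (weight n x y) * f y) * g x)"
    by (subst weight_sym) (simp add: mult_ac)
  then show ?thesis
    by (simp add: cond_mean_kernel)
qed

lemma set_integrable_atom: "L2 M f \<Longrightarrow> set_integrable M (atom n x) f"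
  by (rule L2_set_integrable[OF _ atom_sets atom_finite])

lemma cond_mean_diff: "L2 M f \<Longrightarrow> L2 M g \<Longrightarrow> cond_mean n (f - g) = cond_mean n f - cond_mean n g"
  using set_integral_diff(2)[OF set_integrable_atom set_integrable_atom, of f g n]
  by (auto simp: fun_eq_iff cond_mean_def diff_divide_distrib fun_diff_def)

lemma cond_mean_scale: "cond_mean n (\<lambda>x. a * f x) = (\<lambda>x. a * cond_mean n f x)"
  by (auto simp: fun_eq_iff cond_mean_def)

lemma cond_mean_cnj: "cond_mean n (\<lambda>x. cnj (f x)) x = cnj (cond_mean n f x)"
  using Bochner_Integration.integral_cnj[of M "\<lambda>y. indicat_real (atom n x) y *\<^sub>R f y"]
  by (simp add: cond_mean_def set_lebesgue_integral_def)

lemma cond_mean_inner: "L2 M f \<Longrightarrow> L2 M g \<Longrightarrow> l2_inner M (cond_mean n f) g = l2_inner M f (cond_mean n g)"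
  using cond_mean_sym[of f "\<lambda>x. cnj (g x)" n] by (simp add: l2_inner_def cond_mean_cnj L2_cnj)

text \<open>From level m on every cell lies inside \<open>C\<close> or misses it, so the mean over
  the cell of x is 1 or 0.\<close>

lemma cond_mean_indicator:
  assumes C: "C \<in> P m" and "m \<le> n" and x: "x \<notin> null_part"
  shows "cond_mean n (indicator C) x = indicator C x"
proof (cases "x \<in> C")
  case True
  then have "atom n x \<subseteq> C" using P_nested[OF \<open>m \<le> n\<close> C atom_in[of n x]] mem_atom[of x n] by blast
  then have "set_lebesgue_integral M (atom n x) (indicator C) = (LINT y|M. complex_of_real (indicat_real (atom n x) y))"
    unfolding set_lebesgue_integral_def by (intro Bochner_Integration.integral_cong) (auto simp: indicator_def)
  also have "\<dots> = complex_of_real (measure M (atom n x))" by simp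
  finally show ?thesis using True x measure_atom_pos[OF x, of n] by (simp add: cond_mean_def)
next
  case False
  then have "C \<inter> atom n x = {}" using P_nested[OF \<open>m \<le> n\<close> C atom_in[of n x]] mem_atom[of x n] by blast
  then have "set_lebesgue_integral M (atom n x) (indicator C) = (LINT y|M. 0 :: complex)"
    unfolding set_lebesgue_integral_def by (intro Bochner_Integration.integral_cong) (auto simp: indicator_def)
  then show ?thesis using False by (simp add: cond_mean_def)
qed

section \<open>Totality of the cell indicators and strong convergence of the averages\<close>

lemma Int_stable_cells: "Int_stable (insert {} (\<Union>n. P n))"
proof (rule Int_stableI)
  fix C D assume "C \<in> insert {} (\<Union>n. P n)" "D \<in> insert {} (\<Union>n. P n)"
  then consider "C = {} \<or> D = {}" | m n where "C \<in> P m" "D \<in> P n" by auto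
  then show "C \<inter> D \<in> insert {} (\<Union>n. P n)"
  proof cases
    case (2 m n)
    then show ?thesis
      using P_nested[of m n C D] P_nested[of n m D C] by (cases "m \<le> n") (auto simp: Int_absorb1 Int_absorb2 Int_commute)
  qed auto
qed

text \<open>\<open>h\<close> need not be integrable on the whole space, so the argument runs inside
  each cell \<open>D\<close> of level 0, where it is. There a Dynkin argument extends vanishing
  integrals from cells to all measurable sets.\<close>

lemma cells_total:
  assumes h: "L2 M h" and z: "\<And>n C. C \<in> P n \<Longrightarrow> set_lebesgue_integral M C h = 0"
  shows "AE x in M. h x = 0"
proof -
  have "AE x in M. x \<in> D \<longrightarrow> h x = 0" if D: "D \<in> P 0" for D
  proof -
    have Ds [measurable]: "D \<in> sets M" using D by (rule P_sets)
    have hD: "set_integrable M D h" using h Ds P_finite[OF D] by (rule L2_set_integrable)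
    have sub: "set_integrable M (A \<inter> D) h" if "A \<in> sets M" for A
      using hD that by (rule_tac set_integrable_subset[OF hD]) auto
    have gen: "sets M = sigma_sets UNIV (insert {} (\<Union>n. P n))"
    proof (rule antisym)
      show "sets M \<subseteq> sigma_sets UNIV (insert {} (\<Union>n. P n))"
        unfolding P_generates by (intro sigma_sets_mono') auto
      have "insert {} (\<Union>n. P n) \<subseteq> sets M" using P_sets by auto
      then show "sigma_sets UNIV (insert {} (\<Union>n. P n)) \<subseteq> sets M"
        using sets.sigma_sets_subset[of _ M] by simp
    qed
    have zero: "set_lebesgue_integral M (A \<inter> D) h = 0" if "A \<in> sets M" for A
    proof -
      have A: "A \<in> sigma_sets UNIV (insert {} (\<Union>n. P n))" using that gen by simp
      show ?thesis
      proof (rule sigma_sets_induct_disjoint[where P = "\<lambda>A. set_lebesgue_integral M (A \<inter> D) h = 0",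
            OF Int_stable_cells _ A])
        fix A assume "A \<in> insert {} (\<Union>n. P n)"
        then consider "A = {}" | n where "A \<in> P n" by auto
        then show "set_lebesgue_integral M (A \<inter> D) h = 0"
        proof cases
          case (2 n)
          \<comment> \<open>Level 0 is the coarsest, so a cell of any level lies in \<open>D\<close>
            or misses it.\<close>
          then have "A \<inter> D = A \<or> A \<inter> D = {}" using P_nested[of 0 n D A] D by auto
          then show ?thesis using z[OF 2] by (auto simp: set_lebesgue_integral_def)
        qed (simp add: set_lebesgue_integral_def)
      next
        show "set_lebesgue_integral M ({} \<inter> D) h = 0" by (simp add: set_lebesgue_integral_def)
      next
        fix A assume "A \<in> sigma_sets UNIV (insert {} (\<Union>n. P n))"
          and 0: "set_lebesgue_integral M (A \<inter> D) h = 0"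
        then have A: "A \<in> sets M" using gen by simp
        have "set_lebesgue_integral M (((UNIV - A) \<inter> D) \<union> (A \<inter> D)) h
            = set_lebesgue_integral M ((UNIV - A) \<inter> D) h + set_lebesgue_integral M (A \<inter> D) h"
          using A sets.compl_sets[OF A] by (intro set_integral_Un sub) auto
        moreover have "((UNIV - A) \<inter> D) \<union> (A \<inter> D) = D" by auto
        ultimately show "set_lebesgue_integral M ((UNIV - A) \<inter> D) h = 0" using 0 z[OF D] by simp
      next
        fix A :: "nat \<Rightarrow> 'a set"
        assume disj: "disjoint_family A" and "range A \<subseteq> sigma_sets UNIV (insert {} (\<Union>n. P n))"
          and 0: "\<And>i. set_lebesgue_integral M (A i \<inter> D) h = 0"
        then have A: "A i \<in> sets M" for i using gen by auto
        have U: "(\<Union>i. A i \<inter> D) = (\<Union>i. A i) \<inter> D" by auto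
        have "set_lebesgue_integral M (\<Union>i. A i \<inter> D) h = (\<Sum>i. set_lebesgue_integral M (A i \<inter> D) h)"
        proof (rule lebesgue_integral_countable_add)
          show "(A i \<inter> D) \<inter> (A j \<inter> D) = {}" if "i \<noteq> j" for i j
            using disj that by (auto simp: disjoint_family_on_def)
          show "set_integrable M (\<Union>i. A i \<inter> D) h" unfolding U using sub[of "\<Union>i. A i"] A by auto
        qed (use A in auto)
        also have "\<dots> = 0" using 0 by simp
        finally show "set_lebesgue_integral M ((\<Union>i. A i) \<inter> D) h = 0" unfolding U .
      qed auto
    qed
    have "AE x in M. indicat_real D x *\<^sub>R h x = 0"
    proof (rule density_zero)
      show "integrable M (\<lambda>x. indicat_real D x *\<^sub>R h x)" using hD by (simp add: set_integrable_def)
      fix A assume "A \<in> sets M"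
      then have "set_lebesgue_integral M (A \<inter> D) h = 0" by (rule zero)
      then show "set_lebesgue_integral M A (\<lambda>x. indicat_real D x *\<^sub>R h x) = 0"
        by (simp add: set_lebesgue_integral_def indicator_inter_arith)
    qed
    then show ?thesis by eventually_elim (auto simp: indicator_def)
  qed
  then have "AE x in M. \<forall>D\<in>P 0. x \<in> D \<longrightarrow> h x = 0"
    using countable_P[of 0] by (subst AE_ball_countable) auto
  then show ?thesis
    by eventually_elim (use atom_in mem_atom in blast)
qed

text \<open>The enumeration may repeat cells, and indicators from different levels may be linearly
  dependent; the zero vectors of Gram-Schmidt absorb both.\<close>

definition cell_ind :: "nat \<Rightarrow> 'a \<Rightarrow> complex" where
  "cell_ind k = indicator (from_nat_into (\<Union>n. P n) k)"

definition cell_basis :: "nat \<Rightarrow> 'a \<Rightarrow> complex" where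
  "cell_basis = l2.gram_schmidt M cell_ind"

lemma cells_ne: "(\<Union>n. P n) \<noteq> {}"
  using atom_in by blast

lemma from_nat_into_cells: "\<exists>n. from_nat_into (\<Union>n. P n) k \<in> P n"
  using from_nat_into[OF cells_ne] by blast

lemma L2_cell_ind: "L2 M (cell_ind k)"
  unfolding cell_ind_def using from_nat_into_cells[of k] by (auto intro: L2_indicator_finite P_sets P_finite)

lemma onb_cell_basis: "onb M (range cell_basis - {0})"
  unfolding cell_basis_def
proof (rule onb_range_gram_schmidt[OF L2_cell_ind])
  fix u assume u: "L2 M u" "\<And>k. l2_inner M u (cell_ind k) = 0"
  show "AE x in M. u x = 0"
  proof (rule cells_total[OF u(1)])
    fix n C assume "C \<in> P n"
    then obtain k where k: "C = from_nat_into (\<Union>n. P n) k"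
      using from_nat_into_surj[of "\<Union>n. P n" C] countable_P by auto
    have "set_lebesgue_integral M C u = l2_inner M u (cell_ind k)"
      unfolding set_lebesgue_integral_def l2_inner_def cell_ind_def k
      by (intro Bochner_Integration.integral_cong) (auto simp: indicator_def)
    then show "set_lebesgue_integral M C u = 0" using u(2) by simp
  qed
qed

text \<open>A dense subspace on which strong convergence is trivial. It contains the cell indicators
  and, being a subspace, all that Gram-Schmidt makes of them.\<close>

definition ev_fixed :: "('a \<Rightarrow> complex) set" where
  "ev_fixed = {f. L2 M f \<and> (\<exists>m. \<forall>n\<ge>m. AE x in M. cond_mean n f x = f x)}"

lemma ev_fixed_zero: "0 \<in> ev_fixed"
  by (auto simp: ev_fixed_def cond_mean_def zero_fun_def L2_zero)

lemma ev_fixed_scale: "f \<in> ev_fixed \<Longrightarrow> (\<lambda>x. a * f x) \<in> ev_fixed"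
  unfolding ev_fixed_def by (fastforce simp: cond_mean_scale L2_scale)

lemma ev_fixed_diff:
  assumes "f \<in> ev_fixed" "g \<in> ev_fixed" shows "f - g \<in> ev_fixed"
proof -
  from assms obtain m m' where m: "L2 M f" "L2 M g"
    "\<And>n. n \<ge> m \<Longrightarrow> AE x in M. cond_mean n f x = f x" "\<And>n. n \<ge> m' \<Longrightarrow> AE x in M. cond_mean n g x = g x"
    by (auto simp: ev_fixed_def)
  have "AE x in M. cond_mean n (f - g) x = (f - g) x" if "n \<ge> max m m'" for n
    using m(3)[of n] m(4)[of n] that unfolding cond_mean_diff[OF m(1,2)] by (auto elim: eventually_elim2)
  then show ?thesis unfolding ev_fixed_def using m(1,2)
    by (intro CollectI conjI exI[of _ "max m m'"]) auto
qed

lemma ev_fixed_add: "f \<in> ev_fixed \<Longrightarrow> g \<in> ev_fixed \<Longrightarrow> f + g \<in> ev_fixed"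
  using ev_fixed_diff[OF _ ev_fixed_diff[OF ev_fixed_zero], of f g] by simp

lemma cell_basis_fixed: "cell_basis k \<in> ev_fixed"
  unfolding cell_basis_def
proof (rule l2.gram_schmidt_subspace)
  fix k
  obtain m where m: "from_nat_into (\<Union>n. P n) k \<in> P m" using from_nat_into_cells by blast
  have "AE x in M. cond_mean n (cell_ind k) x = cell_ind k x" if "n \<ge> m" for n
    using AE_not_null by eventually_elim (simp add: cell_ind_def cond_mean_indicator[OF m that])
  then show "cell_ind k \<in> ev_fixed" using L2_cell_ind by (auto simp: ev_fixed_def)
qed (auto intro: ev_fixed_zero ev_fixed_diff ev_fixed_scale)

lemma l2_norm_AE_0: "L2 M f \<Longrightarrow> AE x in M. f x = 0 \<Longrightarrow> l2_norm M f = 0"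
  using l2_inner_eq_0_iff[of M f] by (simp add: l2.nrm_def)

text \<open>Let s be a finite expansion of \<open>f\<close> in the cell basis with error below
  \<epsilon>/2. The averages eventually fix s and never enlarge f - s, so the error is at most twice
  ||f - s||.\<close>

lemma cond_mean_tendsto:
  assumes f: "L2 M f"
  shows "(\<lambda>n. l2_norm M (cond_mean n f - f)) \<longlonglongrightarrow> 0"
proof (rule order_tendstoI)
  fix a :: real assume "a < 0"
  then show "\<forall>\<^sub>F n in sequentially. a < l2_norm M (cond_mean n f - f)"
    using f L2_cond_mean by (auto intro!: always_eventually less_le_trans[of a 0])
next
  fix \<epsilon> :: real assume "0 < \<epsilon>"
  then obtain F where F: "finite F" "F \<subseteq> range cell_basis - {0}" "l2_norm M (f - l2.proj M F f) < \<epsilon> / 2"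
    using onb_approx[OF onb_cell_basis f, of "\<epsilon> / 2"] by auto
  define s where "s = l2.proj M F f"
  have "l2.proj M G f \<in> ev_fixed" if "finite G" "G \<subseteq> range cell_basis - {0}" for G
    using that
  proof (induction G)
    case (insert g G)
    have "l2.proj M (insert g G) f = (\<lambda>x. l2_inner M f g * g x) + l2.proj M G f"
      using insert by (simp add: l2.proj_def)
    moreover have "g \<in> ev_fixed" using insert cell_basis_fixed by auto
    ultimately show ?case using insert by (simp only: ev_fixed_add ev_fixed_scale insert_subset)
  qed (simp add: l2.proj_def ev_fixed_zero)
  from this[OF F(1,2)] obtain m where s: "L2 M s" and m: "\<And>n. n \<ge> m \<Longrightarrow> AE x in M. cond_mean n s x = s x"
    by (auto simp: ev_fixed_def s_def)
  have "l2_norm M (cond_mean n f - f) < \<epsilon>" if "n \<ge> m" for n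
  proof -
    note L = f s L2_cond_mean[OF f, of n] L2_cond_mean[OF s, of n] L2_cond_mean[OF l2.V_diff[OF f s], of n]
    have "l2_norm M (cond_mean n s - s) = 0"
      using m[OF that] L by (intro l2_norm_AE_0) auto
    moreover have split: "cond_mean n f - f = (cond_mean n (f - s) + (cond_mean n s - s)) - (f - s)"
      by (simp add: cond_mean_diff f s)
    have "l2_norm M (cond_mean n f - f) \<le> l2_norm M (cond_mean n (f - s)) + l2_norm M (cond_mean n s - s) + l2_norm M (f - s)"
      unfolding split
      using l2.nrm_diff[OF l2.V_add[OF L(5) l2.V_diff[OF L(4,2)]] l2.V_diff[OF L(1,2)]]
        l2.nrm_add[OF L(5) l2.V_diff[OF L(4,2)]]
      by linarith
    ultimately show ?thesis
      using norm_cond_mean_le[OF l2.V_diff[OF f s], of n] F(3) unfolding s_def by linarith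
  qed
  then show "\<forall>\<^sub>F n in sequentially. l2_norm M (cond_mean n f - f) < \<epsilon>"
    by (auto simp: eventually_sequentially)
qed

lemma cond_mean_inner_tendsto:
  assumes a: "L2 M a" and d: "L2 M d"
  shows "(\<lambda>n. l2_inner M (cond_mean n a) (cond_mean n d)) \<longlonglongrightarrow> l2_inner M a d"
proof -
  have "(\<lambda>n. l2_inner M (cond_mean n a) (cond_mean n d) - l2_inner M a d) \<longlonglongrightarrow> 0"
  proof (rule Lim_null_comparison)
    show "\<forall>\<^sub>F n in sequentially. norm (l2_inner M (cond_mean n a) (cond_mean n d) - l2_inner M a d)
        \<le> l2_norm M (cond_mean n a - a) * l2_norm M d + l2_norm M a * l2_norm M (cond_mean n d - d)"
    proof (intro always_eventually allI)
      fix n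
      note L = a d L2_cond_mean[OF a, of n] L2_cond_mean[OF d, of n]
      have split: "l2_inner M (cond_mean n a) (cond_mean n d) - l2_inner M a d
          = l2_inner M (cond_mean n a - a) (cond_mean n d) + l2_inner M a (cond_mean n d - d)"
        using L by (simp add: l2.b_diff l2.b_diff_right)
      show "norm (l2_inner M (cond_mean n a) (cond_mean n d) - l2_inner M a d)
          \<le> l2_norm M (cond_mean n a - a) * l2_norm M d + l2_norm M a * l2_norm M (cond_mean n d - d)"
        unfolding split
        using norm_triangle_ineq[of "l2_inner M (cond_mean n a - a) (cond_mean n d)" "l2_inner M a (cond_mean n d - d)"]
          l2.b_le_nrm[OF l2.V_diff[OF L(3,1)] L(4)] l2.b_le_nrm[OF L(1) l2.V_diff[OF L(4,2)]]
          mult_left_mono[OF norm_cond_mean_le[OF d, of n] l2.nrm_nonneg[OF l2.V_diff[OF L(3,1)]]]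
        by linarith
    qed
    show "(\<lambda>n. l2_norm M (cond_mean n a - a) * l2_norm M d + l2_norm M a * l2_norm M (cond_mean n d - d)) \<longlonglongrightarrow> 0"
      by (rule tendsto_add_zero[OF tendsto_mult_left_zero[OF cond_mean_tendsto[OF a]] tendsto_mult_right_zero[OF cond_mean_tendsto[OF d]]])
  qed
  then show ?thesis by (simp add: LIM_zero_iff)
qed

section \<open>Integral operators with square-integrable kernel\<close>

lemma L2_tensor:
  assumes f: "L2 M f" and g: "L2 M g"
  shows "L2 (M \<Otimes>\<^sub>M M) (\<lambda>z. f (snd z) * g (fst z))"
    and "(LINT z|(M \<Otimes>\<^sub>M M). (cmod (f (snd z) * g (fst z)))\<^sup>2) = (LINT x|M. (cmod (f x))\<^sup>2) * (LINT x|M. (cmod (g x))\<^sup>2)"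
proof -
  have [measurable]: "f \<in> borel_measurable M" "g \<in> borel_measurable M"
    using f g by (auto intro: L2_measurable)
  have ff: "integrable M (\<lambda>x. (cmod (f x))\<^sup>2)" and gg: "integrable M (\<lambda>x. (cmod (g x))\<^sup>2)"
    using f g by (auto simp: L2_def)
  have "integrable (M \<Otimes>\<^sub>M M) (\<lambda>(x, y). (cmod (g x))\<^sup>2 *\<^sub>R (cmod (f y))\<^sup>2)"
  proof (rule pair.Fubini_integrable)
    show "integrable M (\<lambda>x. LINT y|M. norm (case (x, y) of (x, y) \<Rightarrow> (cmod (g x))\<^sup>2 *\<^sub>R (cmod (f y))\<^sup>2))"
      using gg by (simp add: abs_mult)
    show "AE x in M. integrable M (\<lambda>y. case (x, y) of (x, y) \<Rightarrow> (cmod (g x))\<^sup>2 *\<^sub>R (cmod (f y))\<^sup>2)"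
      using ff by simp
  qed measurable
  then have int: "integrable (M \<Otimes>\<^sub>M M) (\<lambda>z. (cmod (f (snd z) * g (fst z)))\<^sup>2)"
    by (simp add: case_prod_unfold norm_mult power_mult_distrib mult.commute)
  then show "L2 (M \<Otimes>\<^sub>M M) (\<lambda>z. f (snd z) * g (fst z))"
    by (simp add: L2_def)
  have "(LINT z|(M \<Otimes>\<^sub>M M). (cmod (f (snd z) * g (fst z)))\<^sup>2) = (LINT x|M. LINT y|M. (cmod (f y))\<^sup>2 * (cmod (g x))\<^sup>2)"
    using pair.integral_fst'[OF int] by (simp add: norm_mult power_mult_distrib)
  then show "(LINT z|(M \<Otimes>\<^sub>M M). (cmod (f (snd z) * g (fst z)))\<^sup>2) = (LINT x|M. (cmod (f x))\<^sup>2) * (LINT x|M. (cmod (g x))\<^sup>2)"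
    by simp
qed

lemma l2_norm_tensor:
  assumes f: "L2 M f" and g: "L2 M g"
  shows "l2_norm (M \<Otimes>\<^sub>M M) (\<lambda>z. f (snd z) * g (fst z)) = l2_norm M f * l2_norm M g"
proof -
  have "(l2_norm (M \<Otimes>\<^sub>M M) (\<lambda>z. f (snd z) * g (fst z)))\<^sup>2 = (l2_norm M f * l2_norm M g)\<^sup>2"
    using L2_tensor[OF assms] by (simp only: l2_norm_sq power_mult_distrib assms)
  then show ?thesis
    using l2.nrm_nonneg[OF L2_tensor(1)[OF assms]] l2.nrm_nonneg[OF f] l2.nrm_nonneg[OF g]
    by (simp only: power2_eq_iff_nonneg mult_nonneg_nonneg)
qed

text \<open>The transpose without conjugation, which is the adjoint for the bilinear pairing by the
  integral of f g.\<close>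

definition swap_kernel :: "('a \<times> 'a \<Rightarrow> complex) \<Rightarrow> 'a \<times> 'a \<Rightarrow> complex" where
  "swap_kernel K = (\<lambda>(x, y). K (y, x))"

context
  fixes K :: "'a \<times> 'a \<Rightarrow> complex"
  assumes K: "L2 (M \<Otimes>\<^sub>M M) K"
begin

lemma K_measurable [measurable]: "K \<in> borel_measurable (M \<Otimes>\<^sub>M M)"
  using K by (rule L2_measurable)

lemma kernel_integrable:
  assumes "L2 M f" "L2 M g"
  shows "integrable (M \<Otimes>\<^sub>M M) (\<lambda>z. K z * (f (snd z) * g (fst z)))"
  by (rule L2_mult_integrable[OF K L2_tensor(1)[OF assms]])

lemma int_op_pair:
  assumes "L2 M f" "L2 M g"
  shows "(LINT x|M. int_op M K f x * g x) = (LINT z|(M \<Otimes>\<^sub>M M). K z * (f (snd z) * g (fst z)))"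
  using pair.integral_fst'[OF kernel_integrable[OF assms]]
  by (simp add: int_op_def mult.assoc[symmetric])

lemma int_op_inner:
  assumes "L2 M f" "L2 M g"
  shows "l2_inner M (int_op M K f) g = (LINT z|(M \<Otimes>\<^sub>M M). K z * (f (snd z) * cnj (g (fst z))))"
  unfolding l2_inner_def by (rule int_op_pair[OF assms(1) L2_cnj[OF assms(2)]])

text \<open>Cauchy-Schwarz on the product space against the tensor of \<open>f\<close> and
  \<open>g\<close>, whose norm factorises.\<close>

lemma int_op_bound:
  assumes f: "L2 M f" and g: "L2 M g"
  shows "cmod (l2_inner M (int_op M K f) g) \<le> l2_norm (M \<Otimes>\<^sub>M M) K * (l2_norm M f * l2_norm M g)"
proof -
  let ?t = "\<lambda>z. cnj (f (snd z)) * g (fst z)"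
  have t: "L2 (M \<Otimes>\<^sub>M M) ?t" by (rule L2_tensor(1)[OF L2_cnj[OF f] g])
  have "l2_inner M (int_op M K f) g = l2_inner (M \<Otimes>\<^sub>M M) K ?t"
    unfolding int_op_inner[OF f g] by (simp add: l2_inner_def)
  moreover have "l2_norm M (\<lambda>x. cnj (f x)) = l2_norm M f"
    by (simp add: l2.nrm_def l2_inner_self f L2_cnj)
  ultimately show ?thesis
    using l2.b_le_nrm[OF K t] by (simp add: l2_norm_tensor[OF L2_cnj[OF f] g])
qed

lemma int_op_inner_scale:
  assumes "L2 M f" "L2 M g"
  shows "l2_inner M (int_op M K (\<lambda>x. a * f x)) g = a * l2_inner M (int_op M K f) g"
  unfolding int_op_inner[OF L2_scale[OF assms(1)] assms(2)] int_op_inner[OF assms]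
  by (subst integral_mult_right_zero[symmetric]) (simp add: mult_ac)

text \<open>Pointwise linearity can fail at those x where the defining integrals do not exist. It is
  therefore expressed after pairing with \<open>g\<close>, as linearity of an integral over the
  product space.\<close>

lemma int_op_inner_diff:
  assumes f: "L2 M f" and f': "L2 M f'" and g: "L2 M g"
  shows "l2_inner M (int_op M K (f - f')) g = l2_inner M (int_op M K f) g - l2_inner M (int_op M K f') g"
  using kernel_integrable[OF f L2_cnj[OF g]] kernel_integrable[OF f' L2_cnj[OF g]]
  unfolding int_op_inner[OF l2.V_diff[OF f f'] g] int_op_inner[OF f g] int_op_inner[OF f' g]
  by (subst Bochner_Integration.integral_diff[symmetric]) (auto simp: algebra_simps)

lemma int_op_inner_add:
  assumes f: "L2 M f" and f': "L2 M f'" and g: "L2 M g"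
  shows "l2_inner M (int_op M K (f + f')) g = l2_inner M (int_op M K f) g + l2_inner M (int_op M K f') g"
  using kernel_integrable[OF f L2_cnj[OF g]] kernel_integrable[OF f' L2_cnj[OF g]]
  unfolding int_op_inner[OF l2.V_add[OF f f'] g] int_op_inner[OF f g] int_op_inner[OF f' g]
  by (subst Bochner_Integration.integral_add[symmetric]) (auto simp: algebra_simps)

lemma int_op_inner_sum:
  assumes f: "\<And>i. L2 M (f i)" and g: "L2 M g"
  shows "l2_inner M (int_op M K (\<Sum>i<(n::nat). f i)) g = (\<Sum>i<n. l2_inner M (int_op M K (f i)) g)"
proof (induction n)
  case 0
  then show ?case by (simp add: int_op_def l2_inner_def)
next
  case (Suc n)
  have "L2 M (\<Sum>i<n. f i)" using l2.V_sum[of "{..<n}" M f] f by simp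
  then show ?case using Suc f g by (simp only: sum.lessThan_Suc int_op_inner_add)
qed

text \<open>Cauchy-Schwarz on almost every section of \<open>K\<close>; the resulting bound is
  integrable in x by Fubini.\<close>

lemma L2_int_op:
  assumes f: "L2 M f"
  shows "L2 M (int_op M K f)"
proof -
  have [measurable]: "f \<in> borel_measurable M" using f by (rule L2_measurable)
  have meas [measurable]: "int_op M K f \<in> borel_measurable M"
    unfolding int_op_def by measurable
  have KK: "integrable (M \<Otimes>\<^sub>M M) (\<lambda>z. (cmod (K z))\<^sup>2)" using K by (simp add: L2_def)
  have "integrable M (\<lambda>x. (cmod (int_op M K f x))\<^sup>2)"
  proof (rule Bochner_Integration.integrable_bound)
    show "integrable M (\<lambda>x. (LINT y|M. (cmod (K (x, y)))\<^sup>2) * (LINT y|M. (cmod (f y))\<^sup>2))"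
      using pair.integrable_fst'[OF KK] by simp
    show "AE x in M. norm ((cmod (int_op M K f x))\<^sup>2)
        \<le> norm ((LINT y|M. (cmod (K (x, y)))\<^sup>2) * (LINT y|M. (cmod (f y))\<^sup>2))"
      using pair.AE_integrable_fst'[OF KK]
    proof eventually_elim
      fix x assume "integrable M (\<lambda>y. (cmod (K (x, y)))\<^sup>2)"
      then have Kx: "L2 M (\<lambda>y. K (x, y))" by (simp add: L2_def)
      have "int_op M K f x = l2_inner M (\<lambda>y. K (x, y)) (\<lambda>y. cnj (f y))"
        by (simp add: int_op_def l2_inner_def)
      then show "norm ((cmod (int_op M K f x))\<^sup>2) \<le> norm ((LINT y|M. (cmod (K (x, y)))\<^sup>2) * (LINT y|M. (cmod (f y))\<^sup>2))"
        using l2.Cauchy_Schwarz[OF Kx L2_cnj[OF f]] by (simp add: l2_inner_self Kx L2_cnj f)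
    qed
  qed measurable
  then show ?thesis by (simp add: L2_def)
qed

lemma L2_swap_kernel: "L2 (M \<Otimes>\<^sub>M M) (swap_kernel K)"
  using K pair.integrable_product_swap[of "\<lambda>z. (cmod (K z))\<^sup>2"]
  unfolding L2_def swap_kernel_def by (auto simp: case_prod_unfold)

end

lemma int_op_swap:
  assumes K: "L2 (M \<Otimes>\<^sub>M M) K" and f: "L2 M f" and g: "L2 M g"
  shows "(LINT x|M. int_op M K f x * g x) = (LINT x|M. int_op M (swap_kernel K) g x * f x)"
proof -
  have [measurable]: "K \<in> borel_measurable (M \<Otimes>\<^sub>M M)" "f \<in> borel_measurable M" "g \<in> borel_measurable M"
    using K f g by (auto intro: L2_measurable)
  have "(LINT x|M. int_op M (swap_kernel K) g x * f x)
      = (LINT z|(M \<Otimes>\<^sub>M M). swap_kernel K z * (g (snd z) * f (fst z)))"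
    by (rule int_op_pair[OF L2_swap_kernel[OF K] g f])
  also have "\<dots> = (LINT z|(M \<Otimes>\<^sub>M M). K z * (f (snd z) * g (fst z)))"
    by (subst pair.integral_product_swap[symmetric, of "\<lambda>z. K z * (f (snd z) * g (fst z))"])
       (simp_all add: swap_kernel_def case_prod_unfold mult_ac)
  finally show ?thesis using int_op_pair[OF K f g] by simp
qed

section \<open>The operator with averaged kernel\<close>

definition avg :: "nat \<Rightarrow> ('a \<times> 'a \<Rightarrow> complex) \<Rightarrow> 'a \<times> 'a \<Rightarrow> complex" where
  "avg n K = (\<lambda>(u, v). if u \<in> null_part \<or> v \<in> null_part then 0
     else (set_lebesgue_integral M (atom n u) (\<lambda>x. set_lebesgue_integral M (atom n v) (\<lambda>y. K (x, y))))
          / complex_of_real (measure M (atom n u) * measure M (atom n v)))"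

text \<open>For fixed u the outer average is the pairing with the normalised indicator
  \<open>a\<close> of the cell of u. Transposing \<open>K\<close> shows that the averaged kernel, in
  its second variable, is the cell mean of the transpose applied to \<open>a\<close>. Symmetry moves
  this mean onto \<open>f\<close>, and transposing back leaves the average at u.\<close>

lemma int_op_avg:
  assumes K: "L2 (M \<Otimes>\<^sub>M M) K" and f: "L2 M f"
  shows "int_op M (avg n K) f = cond_mean n (int_op M K (cond_mean n f))"
proof
  fix u
  show "int_op M (avg n K) f u = cond_mean n (int_op M K (cond_mean n f)) u"
  proof (cases "u \<in> null_part")
    case True
    then show ?thesis by (simp add: int_op_def avg_def cond_mean_def)
  next
    case False
    let ?m = "complex_of_real (measure M (atom n u))"
    define a :: "'a \<Rightarrow> complex" where "a = (\<lambda>x. (1 / ?m) * indicator (atom n u) x)"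
    have a: "L2 M a" unfolding a_def by (intro L2_scale L2_indicator_finite atom_sets atom_finite)
    have int_a: "(LINT x|M. g x * a x) = set_lebesgue_integral M (atom n u) g / ?m" for g
    proof -
      have "(LINT x|M. g x * a x) = (LINT x|M. indicat_real (atom n u) x *\<^sub>R g x / ?m)"
        by (intro Bochner_Integration.integral_cong) (auto simp: a_def indicator_def)
      then show ?thesis by (simp add: set_lebesgue_integral_def)
    qed
    define G where "G = int_op M (swap_kernel K) a"
    have G: "L2 M G" unfolding G_def by (rule L2_int_op[OF L2_swap_kernel[OF K] a])
    have avg_G: "avg n K (u, v) = cond_mean n G v" for v
    proof (cases "v \<in> null_part")
      case v: False
      have ind: "L2 M (indicator (atom n v))" by (rule L2_indicator_finite[OF atom_sets atom_finite])
      have "set_lebesgue_integral M (atom n v) G = (LINT y|M. G y * indicator (atom n v) y)"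
        unfolding set_lebesgue_integral_def by (intro Bochner_Integration.integral_cong) (auto simp: indicator_def)
      also have "\<dots> = (LINT x|M. int_op M K (indicator (atom n v)) x * a x)"
        unfolding G_def by (rule int_op_swap[OF K ind a, symmetric])
      also have "\<dots> = set_lebesgue_integral M (atom n u) (int_op M K (indicator (atom n v))) / ?m"
        by (rule int_a)
      also have "int_op M K (indicator (atom n v)) = (\<lambda>x. set_lebesgue_integral M (atom n v) (\<lambda>y. K (x, y)))"
        unfolding int_op_def set_lebesgue_integral_def
        by (intro ext Bochner_Integration.integral_cong) (auto simp: indicator_def)
      finally show ?thesis using False v by (simp add: avg_def cond_mean_def)
    qed (simp add: avg_def cond_mean_def)
    have "int_op M (avg n K) f u = (LINT v|M. cond_mean n G v * f v)"
      by (simp add: int_op_def avg_G)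
    also have "\<dots> = (LINT v|M. G v * cond_mean n f v)" by (rule cond_mean_sym[OF G f])
    also have "\<dots> = (LINT x|M. int_op M K (cond_mean n f) x * a x)"
      unfolding G_def by (rule int_op_swap[OF K L2_cond_mean[OF f] a, symmetric])
    also have "\<dots> = cond_mean n (int_op M K (cond_mean n f)) u"
      using False by (simp add: int_a cond_mean_def)
    finally show ?thesis .
  qed
qed

section \<open>Rank-one expansion of a trace-class integral operator\<close>

lemma L2_cell_basis: "L2 M (cell_basis k)"
  using cell_basis_fixed[of k] by (simp add: ev_fixed_def)

text \<open>Unlike in a singular value decomposition, neither family is claimed to be orthogonal.
  The traces need only that the products of the norms are summable, and equal norms reduce this to
  one series.\<close>

lemma trace_class_expansion:
  assumes K: "L2 (M \<Otimes>\<^sub>M M) K" and tc: "trace_class M (int_op M K)"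
  obtains a d :: "nat \<Rightarrow> 'a \<Rightarrow> complex"
  where "\<And>k. L2 M (a k)" "\<And>k. L2 M (d k)"
    and "summable (\<lambda>k. (l2_norm M (a k))\<^sup>2)" and "\<And>k. l2_norm M (d k) = l2_norm M (a k)"
    and "\<And>f g. L2 M f \<Longrightarrow> L2 M g \<Longrightarrow>
      ((\<lambda>k. l2_inner M f (a k) * l2_inner M (d k) g) has_sum l2_inner M (int_op M K f) g) UNIV"
proof -
  let ?T = "int_op M K"
  define \<kappa> where "\<kappa> = l2_norm (M \<Otimes>\<^sub>M M) K"
  have \<kappa>0: "\<kappa> \<ge> 0" unfolding \<kappa>_def by (rule l2.nrm_nonneg[OF K])
  from tc obtain S where abs: "is_abs_op M ?T S"
    and summ: "\<And>B. onb M B \<Longrightarrow> (\<lambda>f. Re (l2_inner M (S f) f)) summable_on B"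
    by (auto simp: trace_class_def)
  have SL: "L2 M (S f)" if "L2 M f" for f using abs that by (auto simp: is_abs_op_def)
  have sa: "l2_inner M (S f) g = l2_inner M f (S g)" if "L2 M f" "L2 M g" for f g
    using abs that by (auto simp: is_abs_op_def)
  have pos: "0 \<le> Re (l2_inner M (S f) f)" if "L2 M f" for f
    using abs that by (auto simp: is_abs_op_def)
  have SS: "l2_inner M (S f) (S g) = l2_inner M (?T f) (?T g)" if "L2 M f" "L2 M g" for f g
    using abs that by (auto simp: is_abs_op_def)
  have TL: "L2 M (?T f)" if "L2 M f" for f by (rule L2_int_op[OF K that])
  have nTS: "l2_norm M (?T f) = l2_norm M (S f)" if "L2 M f" for f
    by (simp add: l2.nrm_def SS that)
  \<comment> \<open>The bound of \<open>S\<close> is inherited from T through ||S f|| = ||T f||: the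
    bilinear bound of T is tested on T f itself, and one factor is cancelled.\<close>
  have bound: "l2_norm M (S f) \<le> \<kappa> * l2_norm M f" if f: "L2 M f" for f
  proof (cases "l2_norm M (S f) = 0")
    case True
    then show ?thesis using \<kappa>0 l2.nrm_nonneg[OF f] by simp
  next
    case False
    then have p: "l2_norm M (S f) > 0" using l2.nrm_nonneg[OF SL[OF f]] by simp
    have "(l2_norm M (S f))\<^sup>2 = Re (l2_inner M (?T f) (?T f))"
      using l2.nrm_sq[OF SL[OF f]] SS[OF f f] by simp
    also have "\<dots> \<le> cmod (l2_inner M (?T f) (?T f))" by (rule complex_Re_le_cmod)
    also have "\<dots> \<le> \<kappa> * (l2_norm M f * l2_norm M (?T f))"
      unfolding \<kappa>_def by (rule int_op_bound[OF K f TL[OF f]])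
    finally have "l2_norm M (S f) * l2_norm M (S f) \<le> (\<kappa> * l2_norm M f) * l2_norm M (S f)"
      by (simp add: nTS[OF f] power2_eq_square mult.assoc)
    then show ?thesis using p by (rule mult_right_le_imp_le)
  qed
  \<comment> \<open>\<open>is_abs_op\<close> does not state that \<open>S\<close> is linear.
    Linearity of the form in its first slot comes from moving \<open>S\<close> to the other side by
    \<open>sa\<close>.\<close>
  interpret F: semi_inner "Collect (L2 M)" "\<lambda>c f x. c * f x" "\<lambda>f g. l2_inner M (S f) g"
    rewrites "\<And>f. f \<in> Collect (L2 M) \<equiv> L2 M f"
  proof -
    show "semi_inner (Collect (L2 M)) (\<lambda>c f x. c * f x) (\<lambda>f g. l2_inner M (S f) g)"
    proof (unfold_locales, unfold mem_Collect_eq)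
      fix f g h :: "'a \<Rightarrow> complex" and c :: complex
      show "L2 M 0" by (rule l2.V_zero)
      show "L2 M f \<Longrightarrow> L2 M g \<Longrightarrow> L2 M (f + g)" by (rule l2.V_add)
      show "L2 M f \<Longrightarrow> L2 M (- f)" by (rule l2.V_minus)
      show "L2 M f \<Longrightarrow> L2 M (\<lambda>x. c * f x)" by (rule L2_scale)
      show "L2 M f \<Longrightarrow> L2 M g \<Longrightarrow> L2 M h \<Longrightarrow> l2_inner M (S (f + g)) h = l2_inner M (S f) h + l2_inner M (S g) h"
        by (simp only: sa l2.V_add l2.b_add SL)
      show "L2 M f \<Longrightarrow> L2 M h \<Longrightarrow> l2_inner M (S (\<lambda>x. c * f x)) h = c * l2_inner M (S f) h"
        by (simp only: sa L2_scale l2.b_scl SL)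
      show "l2_inner M (S g) f = cnj (l2_inner M (S f) g)" if "L2 M f" "L2 M g"
        using l2.b_herm[OF SL[OF that(1)] that(2)] sa[OF that(2,1)] by simp
      show "L2 M f \<Longrightarrow> 0 \<le> Re (l2_inner M (S f) f)" by (rule pos)
    qed
  qed simp
  have form_bound: "Re (l2_inner M (S f) f) \<le> \<kappa> * (l2_norm M f)\<^sup>2" if f: "L2 M f" for f
  proof -
    have "Re (l2_inner M (S f) f) \<le> cmod (l2_inner M (S f) f)" by (rule complex_Re_le_cmod)
    also have "\<dots> \<le> l2_norm M (S f) * l2_norm M f" by (rule l2.b_le_nrm[OF SL[OF f] f])
    also have "\<dots> \<le> (\<kappa> * l2_norm M f) * l2_norm M f"
      by (rule mult_right_mono[OF bound[OF f] l2.nrm_nonneg[OF f]])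
    finally show ?thesis by (simp add: power2_eq_square mult.assoc)
  qed
  \<comment> \<open>Finite combinations of the cell basis are dense in norm and hence, by
    \<open>form_bound\<close>, in the seminorm of the form.\<close>
  define h where "h = F.gram_schmidt cell_basis"
  have wo: "F.weak_orthonormal h"
    unfolding h_def by (rule F.weak_orthonormal_gram_schmidt[OF L2_cell_basis])
  have hL: "L2 M (h k)" for k by (rule F.wo_in[OF wo])
  define r where "r N f = F.resid h N f" for N f
  have rL: "L2 M (r N f)" if "L2 M f" for N f
    unfolding r_def using that hL by (intro F.resid_in) auto
  have r_lim: "(\<lambda>N. Re (l2_inner M (S (r N f)) (r N f))) \<longlonglongrightarrow> 0" if f: "L2 M f" for f
    unfolding r_def
  proof (rule F.resid_tendsto_0[OF wo f])
    fix \<epsilon> :: real assume \<epsilon>: "\<epsilon> > 0"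
    \<comment> \<open>This makes \<kappa> \<delta>^2 < \<epsilon>; the summand 1 covers \<kappa> =
      0.\<close>
    define \<delta> where "\<delta> = sqrt (\<epsilon> / (\<kappa> + 1))"
    have \<delta>: "\<delta> > 0" "\<delta>\<^sup>2 = \<epsilon> / (\<kappa> + 1)" using \<epsilon> \<kappa>0 by (auto simp: \<delta>_def)
    obtain G where G: "finite G" "G \<subseteq> range cell_basis - {0}" "l2_norm M (f - l2.proj M G f) < \<delta>"
      using onb_approx[OF onb_cell_basis f \<delta>(1)] by blast
    define s where "s = l2.proj M G f"
    have GL: "L2 M g" if "g \<in> G" for g using G(2) that L2_cell_basis by auto
    have s: "L2 M s" unfolding s_def l2.proj_def
      by (rule l2.V_sum) (rule L2_scale, rule GL)
    have fs: "L2 M (f - s)" by (rule l2.V_diff[OF f s])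
    have nd: "(l2_norm M (f - s))\<^sup>2 \<le> \<delta>\<^sup>2"
      using G(3) l2.nrm_nonneg[OF fs] unfolding s_def by (intro power_mono) auto
    have "Re (l2_inner M (S (f - s)) (f - s)) \<le> \<kappa> * (\<epsilon> / (\<kappa> + 1))"
      using form_bound[OF fs] mult_left_mono[OF nd \<kappa>0] unfolding \<delta>(2) by linarith
    also have "\<dots> < \<epsilon>" using \<epsilon> \<kappa>0 by (simp add: field_simps)
    finally have small: "Re (l2_inner M (S (f - s)) (f - s)) < \<epsilon>" .
    \<comment> \<open>\<open>s\<close> involves only basis vectors with index below some N, and each
      of them has null remainder at stage N.\<close>
    obtain I where I: "finite I" "G = cell_basis ` I"
      using finite_subset_image[OF G(1), of cell_basis UNIV] G(2) by auto
    obtain N where N: "\<And>i. i \<in> I \<Longrightarrow> i < N"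
      using finite_nat_set_iff_bounded[of I] I(1) by blast
    have "l2_inner M (S (F.resid h N s)) u = 0" if u: "L2 M u" for u
    proof -
      have "l2_inner M (S (F.resid h N g)) u = 0" if gG: "g \<in> G" for g
      proof -
        obtain j where j: "g = cell_basis j" "j < N" using I(2) N gG by auto
        show ?thesis unfolding j(1) h_def
          by (rule F.resid_null_inner[OF wo[unfolded h_def] L2_cell_basis u F.resid_gram_schmidt[OF L2_cell_basis j(2)]])
      qed
      then show ?thesis
        unfolding s_def l2.proj_def using F.resid_sum_scl[OF wo, of G "\<lambda>g. g" u N "\<lambda>g. l2_inner M f g"] GL u
        by simp
    qed
    then have "Re (l2_inner M (S (F.resid h N s)) (F.resid h N s)) = 0"
      using rL[OF s, of N] by (simp add: r_def)
    then show "\<exists>s\<in>Collect (L2 M). Re (l2_inner M (S (f - s)) (f - s)) < \<epsilon>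
        \<and> (\<exists>N. Re (l2_inner M (S (F.resid h N s)) (F.resid h N s)) = 0)"
      using s small by blast
  qed
  define a where "a k = S (h k)" for k
  define d where "d k = ?T (h k)" for k
  have aL: "L2 M (a k)" and dL: "L2 M (d k)" for k
    unfolding a_def d_def by (auto intro: SL TL hL)
  have fh: "l2_inner M (S f) (h k) = l2_inner M f (a k)" if "L2 M f" for f k
    unfolding a_def by (rule sa[OF that hL])
  have da: "l2_norm M (d k) = l2_norm M (a k)" for k
    unfolding a_def d_def by (rule nTS[OF hL])
  \<comment> \<open>Parseval for the form: the partial sums of the squares are what
    \<open>r N f\<close> has lost, and \<open>r N f\<close> tends to 0 in the seminorm.\<close>
  have sq_sum: "((\<lambda>k. (cmod (l2_inner M f (a k)))\<^sup>2) has_sum Re (l2_inner M (S f) f)) UNIV" if f: "L2 M f" for f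
  proof (rule sums_nonneg_imp_has_sum)
    have "(\<lambda>N. Re (l2_inner M (S f) f) - Re (l2_inner M (S (r N f)) (r N f))) \<longlonglongrightarrow> Re (l2_inner M (S f) f) - 0"
      by (intro tendsto_diff tendsto_const r_lim f)
    then show "(\<lambda>k. (cmod (l2_inner M f (a k)))\<^sup>2) sums Re (l2_inner M (S f) f)"
      unfolding sums_def r_def F.resid_self[OF wo f] by (simp add: fh f)
  qed simp
  \<comment> \<open>The summability over bases in \<open>trace_class\<close> enters here. Summing
    \<open>sq_sum\<close> over the cell basis gives the finite trace of \<open>S\<close>; summing
    over the basis first gives sum_k ||a_k||^2.\<close>
  have "(\<lambda>k. (l2_norm M (a k))\<^sup>2) summable_on UNIV"
  proof -
    let ?B = "range cell_basis - {0}"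
    let ?G = "\<lambda>(f, k). (cmod (l2_inner M f (a k)))\<^sup>2"
    have BL: "L2 M f" if "f \<in> ?B" for f using that L2_cell_basis by auto
    have "?G summable_on (?B \<times> UNIV)"
      by (rule summable_on_SigmaI[OF _ summ[OF onb_cell_basis]]) (auto intro: sq_sum L2_cell_basis)
    then obtain t where "(?G has_sum t) (?B \<times> UNIV)" by (auto simp: summable_on_def)
    then have "((\<lambda>(k, f). ?G (f, k)) has_sum t) (UNIV \<times> ?B)"
      by (subst (asm) has_sum_swap) (simp add: case_prod_unfold)
    then have "((\<lambda>k. (l2_norm M (a k))\<^sup>2) has_sum t) UNIV"
    proof (rule has_sum_SigmaD)
      fix k
      have "cmod (l2_inner M (a k) f) = cmod (l2_inner M f (a k))" if "f \<in> ?B" for f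
        using l2.b_herm[OF aL[of k] BL[OF that]] by simp
      then show "((\<lambda>f. case (k, f) of (k, f) \<Rightarrow> ?G (f, k)) has_sum (l2_norm M (a k))\<^sup>2) ?B"
        using Parseval[OF onb_cell_basis aL[of k]] unfolding l2_norm_sq[OF aL]
        by (subst has_sum_cong[where g = "\<lambda>f. (cmod (l2_inner M (a k) f))\<^sup>2"]) auto
    qed
    then show ?thesis by (auto simp: summable_on_def)
  qed
  then have a_summable: "summable (\<lambda>k. (l2_norm M (a k))\<^sup>2)" by (rule summable_on_imp_summable)
  have expansion: "((\<lambda>k. l2_inner M f (a k) * l2_inner M (d k) g) has_sum l2_inner M (?T f) g) UNIV"
    if f: "L2 M f" and g: "L2 M g" for f g
  proof (rule norm_summable_imp_has_sum)
    show "summable (\<lambda>k. norm (l2_inner M f (a k) * l2_inner M (d k) g))"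
    proof (rule summable_comparison_test')
      show "summable (\<lambda>k. l2_norm M f * l2_norm M g * (l2_norm M (a k))\<^sup>2)"
        by (rule summable_mult[OF a_summable])
      fix k
      have "cmod (l2_inner M f (a k)) * cmod (l2_inner M (d k) g) \<le> (l2_norm M f * l2_norm M (a k)) * (l2_norm M (d k) * l2_norm M g)"
        using l2.b_le_nrm[OF f aL] l2.b_le_nrm[OF dL g] l2.nrm_nonneg[OF f] l2.nrm_nonneg[OF aL]
        by (intro mult_mono) auto
      then show "norm (norm (l2_inner M f (a k) * l2_inner M (d k) g)) \<le> l2_norm M f * l2_norm M g * (l2_norm M (a k))\<^sup>2"
        by (simp add: norm_mult da power2_eq_square mult_ac)
    qed
    have part: "(\<Sum>k<N. l2_inner M f (a k) * l2_inner M (d k) g) = l2_inner M (?T f) g - l2_inner M (?T (r N f)) g" for N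
    proof -
      have hk: "L2 M (\<lambda>x. l2_inner M (S f) (h k) * h k x)" for k by (rule L2_scale[OF hL])
      have "L2 M (\<Sum>k<N. (\<lambda>x. l2_inner M (S f) (h k) * h k x))" by (rule l2.V_sum) (rule hk)
      then have "l2_inner M (?T (r N f)) g
          = l2_inner M (?T f) g - (\<Sum>k<N. l2_inner M (?T (\<lambda>x. l2_inner M (S f) (h k) * h k x)) g)"
        unfolding r_def F.resid_def by (simp only: int_op_inner_diff[OF K f _ g] int_op_inner_sum[OF K hk g])
      then show ?thesis by (simp add: int_op_inner_scale[OF K hL g] fh f d_def)
    qed
    have "(\<lambda>N. l2_inner M (?T (r N f)) g) \<longlonglongrightarrow> 0"
    proof (rule Lim_null_comparison)
      \<comment> \<open>Cauchy-Schwarz for the form, applied to u and S u: with q = ||S u||^2, q^2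
        <= <S u, u> <S (S u), S u> <= <S u, u> \<kappa> q, and q cancels.\<close>
      have r_bound: "l2_norm M (S u) \<le> sqrt (\<kappa> * Re (l2_inner M (S u) u))" if u: "L2 M u" for u
      proof (rule real_le_rsqrt)
        define q where "q = (l2_norm M (S u))\<^sup>2"
        have "q = Re (l2_inner M (S u) (S u))" unfolding q_def by (rule l2.nrm_sq[OF SL[OF u]])
        then have n_le: "q \<le> cmod (l2_inner M (S u) (S u))" using complex_Re_le_cmod by simp
        have n0: "0 \<le> q" by (simp add: q_def)
        have "q\<^sup>2 \<le> (cmod (l2_inner M (S u) (S u)))\<^sup>2" using n_le by (intro power_mono n0)
        also have "\<dots> \<le> Re (l2_inner M (S u) u) * Re (l2_inner M (S (S u)) (S u))"
          by (rule F.Cauchy_Schwarz[OF u SL[OF u]])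
        also have "\<dots> \<le> Re (l2_inner M (S u) u) * (\<kappa> * q)"
          unfolding q_def by (rule mult_left_mono[OF form_bound[OF SL[OF u]] pos[OF u]])
        finally have "q * q \<le> (\<kappa> * Re (l2_inner M (S u) u)) * q"
          by (simp add: power2_eq_square[of "q"] mult_ac)
        then have "q \<le> \<kappa> * Re (l2_inner M (S u) u)" if "q \<noteq> 0"
          using n0 that by (intro mult_right_le_imp_le[of q q]) auto
        then show "(l2_norm M (S u))\<^sup>2 \<le> \<kappa> * Re (l2_inner M (S u) u)"
          using \<kappa>0 pos[OF u] unfolding q_def[symmetric] by (cases "q = 0") auto
      qed
      show "\<forall>\<^sub>F N in sequentially. norm (l2_inner M (?T (r N f)) g)
          \<le> sqrt (\<kappa> * Re (l2_inner M (S (r N f)) (r N f))) * l2_norm M g"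
      proof (intro always_eventually allI)
        fix N
        have "norm (l2_inner M (?T (r N f)) g) \<le> l2_norm M (?T (r N f)) * l2_norm M g"
          by (rule l2.b_le_nrm[OF TL[OF rL[OF f]] g])
        also have "\<dots> \<le> sqrt (\<kappa> * Re (l2_inner M (S (r N f)) (r N f))) * l2_norm M g"
          unfolding nTS[OF rL[OF f]] by (rule mult_right_mono[OF r_bound[OF rL[OF f]] l2.nrm_nonneg[OF g]])
        finally show "norm (l2_inner M (?T (r N f)) g)
          \<le> sqrt (\<kappa> * Re (l2_inner M (S (r N f)) (r N f))) * l2_norm M g" .
      qed
      have "(\<lambda>N. sqrt (\<kappa> * Re (l2_inner M (S (r N f)) (r N f)))) \<longlonglongrightarrow> sqrt (\<kappa> * 0)"
        by (intro tendsto_real_sqrt tendsto_mult tendsto_const r_lim f)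
      then show "(\<lambda>N. sqrt (\<kappa> * Re (l2_inner M (S (r N f)) (r N f))) * l2_norm M g) \<longlonglongrightarrow> 0"
        by (intro tendsto_mult_left_zero) simp
    qed
    from tendsto_diff[OF tendsto_const[of "l2_inner M (?T f) g"] this]
    show "(\<lambda>k. l2_inner M f (a k) * l2_inner M (d k) g) sums l2_inner M (?T f) g"
      unfolding sums_def part by simp
  qed
  show thesis by (rule that[OF aL dL a_summable da expansion])
qed

theorem trace_avg_tendsto:
  assumes K: "L2 (M \<Otimes>\<^sub>M M) K" and tc: "trace_class M (int_op M K)"
  shows "(\<lambda>n. trace M (int_op M (avg n K))) \<longlonglongrightarrow> trace M (int_op M K)"
proof -
  from trace_class_expansion[OF K tc] obtain a d
    where aL: "\<And>k. L2 M (a k)" and dL: "\<And>k. L2 M (d k)"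
      and a_summable: "summable (\<lambda>k. (l2_norm M (a k))\<^sup>2)" and da: "\<And>k. l2_norm M (d k) = l2_norm M (a k)"
      and expansion: "\<And>f g. L2 M f \<Longrightarrow> L2 M g \<Longrightarrow>
      ((\<lambda>k. l2_inner M f (a k) * l2_inner M (d k) g) has_sum l2_inner M (int_op M K f) g) UNIV"
    by blast
  \<comment> \<open>The basis chosen inside \<open>trace\<close>; the cell basis witnesses that
    there is one to choose.\<close>
  define B where "B = (SOME B. onb M B)"
  have B: "onb M B" unfolding B_def using onb_cell_basis by (rule someI)
  have as: "(\<lambda>k. (l2_norm M (a k))\<^sup>2) summable_on UNIV"
    using a_summable by (subst summable_on_UNIV_nonneg_real_iff) auto
  have infsum_eq: "(\<Sum>\<^sub>\<infinity>k. l2_inner M (d' k) (a' k)) = (\<Sum>k. l2_inner M (d' k) (a' k))"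
    if "\<And>k. L2 M (a' k)" "\<And>k. L2 M (d' k)" "\<And>k. l2_norm M (a' k) \<le> l2_norm M (a k)" "\<And>k. l2_norm M (d' k) \<le> l2_norm M (a k)"
    for a' d'
  proof -
    have "summable (\<lambda>k. norm (l2_inner M (d' k) (a' k)))"
    proof (rule summable_comparison_test'[OF a_summable])
      fix k
      have "norm (l2_inner M (d' k) (a' k)) \<le> l2_norm M (d' k) * l2_norm M (a' k)"
        by (rule l2.b_le_nrm[OF that(2,1)])
      also have "\<dots> \<le> l2_norm M (a k) * l2_norm M (a k)"
        by (rule mult_mono[OF that(4,3) l2.nrm_nonneg[OF aL] l2.nrm_nonneg[OF that(1)]])
      finally show "norm (norm (l2_inner M (d' k) (a' k))) \<le> (l2_norm M (a k))\<^sup>2"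
        by (simp add: power2_eq_square)
    qed
    then show ?thesis
      by (intro infsumI norm_summable_imp_has_sum) (auto intro: summable_sums summable_norm_cancel)
  qed
  have "((\<lambda>f. l2_inner M (int_op M K f) f) has_sum (\<Sum>\<^sub>\<infinity>k. l2_inner M (d k) (a k))) B"
    by (rule has_sum_trace[OF B dL aL _ as]) (auto simp: da as intro!: expansion onb_L2[OF B])
  then have tr: "trace M (int_op M K) = (\<Sum>k. l2_inner M (d k) (a k))"
    unfolding trace_def B_def[symmetric] by (subst infsum_eq[symmetric]) (auto simp: infsumI aL dL da)
  have tr_avg: "trace M (int_op M (avg n K)) = (\<Sum>k. l2_inner M (cond_mean n (d k)) (cond_mean n (a k)))" for n
  proof -
    have a's: "(\<lambda>k. (l2_norm M (cond_mean n (a k)))\<^sup>2) summable_on UNIV"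
      and d's: "(\<lambda>k. (l2_norm M (cond_mean n (d k)))\<^sup>2) summable_on UNIV"
      using norm_cond_mean_le[OF aL, of n] norm_cond_mean_le[OF dL, of n] l2.nrm_nonneg[OF L2_cond_mean[OF aL]] l2.nrm_nonneg[OF L2_cond_mean[OF dL]]
      by (auto intro!: summable_on_comparison_test[OF as] power_mono simp: da)
    have "((\<lambda>f. l2_inner M (int_op M (avg n K) f) f) has_sum (\<Sum>\<^sub>\<infinity>k. l2_inner M (cond_mean n (d k)) (cond_mean n (a k)))) B"
    proof (rule has_sum_trace[OF B L2_cond_mean[OF dL] L2_cond_mean[OF aL] d's a's])
      fix f assume "f \<in> B"
      then have f: "L2 M f" by (rule onb_L2[OF B])
      \<comment> \<open>The outer average moves onto the second f, so the expansion of the original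
        operator is evaluated at the cell mean of f in both slots. Symmetry then shifts the means
        onto \<open>a k\<close> and \<open>d k\<close>.\<close>
      have "l2_inner M (int_op M (avg n K) f) f = l2_inner M (int_op M K (cond_mean n f)) (cond_mean n f)"
        unfolding int_op_avg[OF K f] by (rule cond_mean_inner[OF L2_int_op[OF K L2_cond_mean[OF f]] f])
      then show "((\<lambda>k. l2_inner M f (cond_mean n (a k)) * l2_inner M (cond_mean n (d k)) f) has_sum l2_inner M (int_op M (avg n K) f) f) UNIV"
        using expansion[OF L2_cond_mean[OF f] L2_cond_mean[OF f]] by (simp add: cond_mean_inner[OF f aL] cond_mean_inner[OF dL f])
    qed
    then show ?thesis
      unfolding trace_def B_def[symmetric]
      by (subst infsum_eq[symmetric])
         (auto simp: infsumI L2_cond_mean aL dL norm_cond_mean_le intro: order_trans[OF norm_cond_mean_le[OF dL]] simp: da)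
  qed
  have "((\<lambda>n. \<Sum>k. l2_inner M (cond_mean n (d k)) (cond_mean n (a k))) \<longlonglongrightarrow> (\<Sum>k. l2_inner M (d k) (a k)))"
  \<comment> \<open>The majorant ||a_k||^2 is independent of n because averaging is a
    contraction.\<close>
  proof (rule tannerys_theorem[THEN conjunct2, THEN conjunct2])
    show "(\<lambda>n. l2_inner M (cond_mean n (d k)) (cond_mean n (a k))) \<longlonglongrightarrow> l2_inner M (d k) (a k)" for k
      by (rule cond_mean_inner_tendsto[OF dL aL])
    have "norm (l2_inner M (cond_mean n (d k)) (cond_mean n (a k))) \<le> (l2_norm M (a k))\<^sup>2" for k n
    proof -
      have "norm (l2_inner M (cond_mean n (d k)) (cond_mean n (a k))) \<le> l2_norm M (cond_mean n (d k)) * l2_norm M (cond_mean n (a k))"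
        by (rule l2.b_le_nrm[OF L2_cond_mean[OF dL] L2_cond_mean[OF aL]])
      also have "\<dots> \<le> l2_norm M (d k) * l2_norm M (a k)"
        by (rule mult_mono[OF norm_cond_mean_le[OF dL] norm_cond_mean_le[OF aL] l2.nrm_nonneg[OF dL] l2.nrm_nonneg[OF L2_cond_mean[OF aL]]])
      finally show ?thesis by (simp add: da power2_eq_square)
    qed
    then show "\<forall>\<^sub>F (k, n) in sequentially \<times>\<^sub>F sequentially.
        norm (l2_inner M (cond_mean n (d k)) (cond_mean n (a k))) \<le> (l2_norm M (a k))\<^sup>2"
      by (intro always_eventually) auto
  qed (use a_summable in auto)
  then show ?thesis unfolding tr tr_avg .
qed

end

section \<open>The partitions of the cover and the base\<close>

lemma compact_finite_emeasure:
  assumes borel: "sets M = sets borel" and "compact C"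
    and loc_finite: "\<forall>x. \<exists>V. open V \<and> x \<in> V \<and> emeasure M V < \<infinity>"
  shows "emeasure M C < \<infinity>"
proof -
  from loc_finite obtain V where V: "\<And>x. open (V x)" "\<And>x. x \<in> V x" "\<And>x. emeasure M (V x) < \<infinity>"
    by metis
  obtain D where D: "D \<subseteq> C" "finite D" "C \<subseteq> (\<Union>x\<in>D. V x)"
    using compactE_image[OF \<open>compact C\<close>, of C V] V by blast
  have "emeasure M C \<le> emeasure M (\<Union>x\<in>D. V x)"
    using D V by (intro emeasure_mono) (auto simp: borel)
  also have "\<dots> \<le> (\<Sum>x\<in>D. emeasure M (V x))"
    using D V by (intro emeasure_subadditive_finite) (auto simp: borel)
  also have "\<dots> < \<infinity>" using D V by simp
  finally show ?thesis .
qed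

text \<open>The base provides the generating property: \<open>U n\<close> is a union of countably
  many cells of level n + 1, and the sets \<open>U n\<close> generate the Borel sets.\<close>

lemma refining_partitions_part:
  fixes M :: "'a::{t2_space, second_countable_topology} measure"
    and A U :: "nat \<Rightarrow> 'a set"
  assumes borel: "sets M = sets borel"
    and sigma_fin: "sigma_finite_measure M"
    and loc_finite: "\<forall>x. \<exists>V. open V \<and> x \<in> V \<and> emeasure M V < \<infinity>"
    and cover_int: "\<forall>k. \<exists>C. compact C \<and> A k = interior C"
    and cover: "(\<Union>k. A k) = UNIV"
    and base: "topological_basis (range U)"
  shows "refining_partitions M (part A U)"
proof -
  interpret sigma_finite_measure M by (rule sigma_fin)
  have openA: "open (A k)" for k using cover_int by (metis open_interior)
  have openU: "open (U n)" for n using base by (auto simp: topological_basis_def)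
  have clU: "closure (\<Union>i<k. A i) = (\<Union>i<k. closure (A i))" for k :: nat
    by (induction k) (auto simp: lessThan_Suc)
  have part0_cases: "\<exists>k. B = A k - closure (\<Union>i<k. A i) \<or> B = frontier (A k) - closure (\<Union>i<k. A i)"
    if "B \<in> part0 A" for B
    using that by (auto simp: part0_def)
  \<comment> \<open>The cell of x is decided by the first k with x in the closure of
    \<open>A k\<close>; as \<open>A k\<close> is open, x then lies either in \<open>A k\<close> or
    on its frontier.\<close>
  have unique0: "\<exists>!B. B \<in> part0 A \<and> x \<in> B" for x
  proof -
    obtain j where "x \<in> A j" using cover by blast
    then have ex: "\<exists>k. x \<in> closure (A k)" using closure_subset by blast
    define k where "k = (LEAST k. x \<in> closure (A k))"
    have k: "x \<in> closure (A k)" unfolding k_def using ex by (rule LeastI_ex)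
    have less: "x \<notin> closure (A i)" if "i < k" for i using that unfolding k_def by (rule not_less_Least)
    have eq: "i = k" if "x \<in> closure (A i)" "x \<notin> closure (\<Union>j<i. A j)" for i
      using that less k by (cases i k rule: linorder_cases) (auto simp: clU)
    let ?B = "(if x \<in> A k then A k else frontier (A k)) - closure (\<Union>i<k. A i)"
    show ?thesis
    proof (rule ex1I[of _ ?B])
      show "?B \<in> part0 A \<and> x \<in> ?B"
        using k less openA[of k] by (auto simp: part0_def clU frontier_def interior_open)
    next
      fix B assume B: "B \<in> part0 A \<and> x \<in> B"
      then obtain i where i: "B = A i - closure (\<Union>j<i. A j) \<or> B = frontier (A i) - closure (\<Union>j<i. A j)"
        using part0_cases by blast
      then have "x \<in> closure (A i)" "x \<notin> closure (\<Union>j<i. A j)"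
        using B closure_subset[of "A i"] by (auto simp: frontier_def)
      then have "i = k" by (rule eq)
      then show "B = ?B" using i B openA[of k] by (auto simp: frontier_def interior_open)
    qed
  qed
  have unique: "\<exists>!B. B \<in> part A U n \<and> x \<in> B" for n x
  proof (induction n)
    case 0
    then show ?case using unique0 by simp
  next
    case (Suc n)
    then obtain B where B: "B \<in> part A U n" "x \<in> B" and uniq: "\<And>B'. B' \<in> part A U n \<Longrightarrow> x \<in> B' \<Longrightarrow> B' = B"
      by auto
    \<comment> \<open>An open set, its frontier and the complement of its closure partition the
      space; W is the part that contains x.\<close>
    define W where "W = (if x \<in> U n then U n else if x \<in> closure (U n) then frontier (U n) else - closure (U n))"
    have xW: "x \<in> W" using openU[of n] by (auto simp: W_def frontier_def interior_open)
    have W_uniq: "W' = W" if "W' \<in> {U n, - closure (U n), frontier (U n)}" "x \<in> W'" for W'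
      using that openU[of n] closure_subset[of "U n"] by (auto simp: W_def frontier_def interior_open)
    show ?case
    proof (rule ex1I[of _ "W \<inter> B"])
      show "W \<inter> B \<in> part A U (Suc n) \<and> x \<in> W \<inter> B"
        using B xW by (auto simp: W_def)
    next
      fix D assume D: "D \<in> part A U (Suc n) \<and> x \<in> D"
      then obtain B' W' where "B' \<in> part A U n" "D = W' \<inter> B'" "W' \<in> {U n, - closure (U n), frontier (U n)}"
        by auto
      then show "D = W \<inter> B" using D uniq[of B'] W_uniq[of W'] by auto
    qed
  qed
  have count: "countable (part A U n)" for n
    by (induction n) (auto simp: part0_def)
  have meas: "C \<in> sets borel" if "C \<in> part A U n" for C n
    using that
  proof (induction n arbitrary: C)
    case 0
    then show ?case using part0_cases[of C] openA by auto
  next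
    case (Suc n)
    then obtain B W where "B \<in> part A U n" "C = W \<inter> B" "W \<in> {U n, - closure (U n), frontier (U n)}"
      by auto
    moreover from this have "W \<in> sets borel" using openU[of n] by auto
    ultimately show ?case using Suc.IH by auto
  qed
  have refine: "\<exists>C\<in>part A U n. D \<subseteq> C" if "D \<in> part A U (Suc n)" for D n
    using that by auto
  have fin: "emeasure M C < \<infinity>" if "C \<in> part A U n" for C n
  proof -
    \<comment> \<open>Frontier cells lie outside \<open>A k\<close>, so finiteness is read off from
      the compact set with interior \<open>A k\<close>: it contains the closure, and a locally
      finite measure is finite on it.\<close>
    have "\<exists>k. C \<subseteq> closure (A k)"
      using that
    proof (induction n arbitrary: C)
      case 0
      then show ?case using part0_cases[of C] closure_subset by (auto simp: frontier_def)
    next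
      case (Suc n)
      then show ?case using refine by (meson subset_trans)
    qed
    then obtain k where k: "C \<subseteq> closure (A k)" by blast
    obtain D where D: "compact D" "A k = interior D" using cover_int by blast
    have "closure (A k) \<subseteq> D"
      unfolding D(2) by (rule closure_minimal[OF interior_subset compact_imp_closed[OF D(1)]])
    then have "emeasure M C \<le> emeasure M D"
      using k compact_imp_closed[OF D(1)] by (intro emeasure_mono) (auto simp: borel)
    then show ?thesis using compact_finite_emeasure[OF borel D(1) loc_finite] by simp
  qed
  have space: "space M = UNIV" using sets_eq_imp_space_eq[OF borel] by simp
  have gen: "sets M = sigma_sets UNIV (\<Union>n. part A U n)"
  proof (rule antisym)
    have "U n \<in> sigma_sets UNIV (\<Union>n. part A U n)" for n
    proof -
      interpret G: sigma_algebra UNIV "sigma_sets UNIV (\<Union>n. part A U n)"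
        by (rule sigma_algebra_sigma_sets) simp
      have "U n = \<Union> ((\<lambda>B. U n \<inter> B) ` part A U n)" using ex1_implies_ex[OF unique[of n]] by blast
      moreover have "\<Union> ((\<lambda>B. U n \<inter> B) ` part A U n) \<in> sigma_sets UNIV (\<Union>n. part A U n)"
      proof (rule G.countable_Union)
        show "countable ((\<lambda>B. U n \<inter> B) ` part A U n)" using count by simp
        have "(\<lambda>B. U n \<inter> B) ` part A U n \<subseteq> part A U (Suc n)" by auto
        then show "(\<lambda>B. U n \<inter> B) ` part A U n \<subseteq> sigma_sets UNIV (\<Union>n. part A U n)"
          by (blast intro: sigma_sets.Basic)
      qed
      ultimately show ?thesis by simp
    qed
    then have "sigma_sets UNIV (range U) \<subseteq> sigma_sets UNIV (\<Union>n. part A U n)"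
      by (intro sigma_sets_mono) auto
    moreover have "sets borel = sigma_sets UNIV (range U)"
      by (subst borel_eq_countable_basis[OF _ base]) auto
    ultimately show "sets M \<subseteq> sigma_sets UNIV (\<Union>n. part A U n)" by (simp add: borel)
    have "(\<Union>n. part A U n) \<subseteq> sets M" using meas borel by blast
    then show "sigma_sets UNIV (\<Union>n. part A U n) \<subseteq> sets M"
      using sets.sigma_sets_subset[of _ M] space by simp
  qed
  show ?thesis
  proof (intro refining_partitions.intro[OF sigma_fin] refining_partitions_axioms.intro)
    show "C \<in> part A U n \<Longrightarrow> C \<in> sets M" for C n using meas borel by simp
  qed (fact space count fin unique refine gen)+
qed

theorem theorem4p8:
  fixes M :: "'a::{t2_space, second_countable_topology} measure"
    and A U :: "nat \<Rightarrow> 'a set"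
    and K :: "'a \<times> 'a \<Rightarrow> complex"
  assumes loc_compact: "locally_compact_space (euclidean :: 'a topology)"
    and borel: "sets M = sets borel"
    and sigma_fin: "sigma_finite_measure M"
    and loc_finite: "\<forall>x. \<exists>V. open V \<and> x \<in> V \<and> emeasure M V < \<infinity>"
    and nondegenerate: "\<forall>V. open V \<and> V \<noteq> {} \<longrightarrow> emeasure M V > 0"
    and cover_int: "\<forall>k. \<exists>C. compact C \<and> A k = interior C"
    and cover_fin: "\<forall>k. emeasure M (A k) < \<infinity>"
    and cover: "(\<Union>k. A k) = UNIV"
    and base: "topological_basis (range U)"
    and K_meas: "K \<in> borel_measurable (M \<Otimes>\<^sub>M M)"
    and K_L2: "integrable (M \<Otimes>\<^sub>M M) (\<lambda>z. (cmod (K z))\<^sup>2)"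
    and tc: "trace_class M (int_op M K)"
  shows "(\<lambda>n. trace M (int_op M (avg_kernel M A U n K))) \<longlonglongrightarrow> trace M (int_op M K)"
proof -
  interpret refining_partitions M "part A U"
    by (rule refining_partitions_part[OF borel sigma_fin loc_finite cover_int cover base])
  have atom: "cell A U n = atom n" for n
    by (simp add: fun_eq_iff cell_def atom_def)
  have null: "null_cells M A U = null_part"
    by (simp add: null_cells_def null_part_def atom)
  have avg: "avg_kernel M A U n K = avg n K" for n
    unfolding avg_kernel_def avg_def atom null by (rule refl)
  have "L2 (M \<Otimes>\<^sub>M M) K" unfolding L2_def using K_meas K_L2 by (rule conjI)
  from trace_avg_tendsto[OF this tc] show ?thesis unfolding avg .
qed

end
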